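(* Let $\Omega\subseteq\mathbb{R}^n$ be a bounded John domain. Let $w_1,w_2$ be nonnegative measurable functions on $\mathbb{R}^n$ for which there exists a constant $K<\infty$ such that $$Mw_1(x)\le K\,w_2(x)$$ for almost all $x\in\mathbb{R}^n$. Then there is a constant $C$, independent of $f$, such that $$\inf_{a\in\mathbb{R}}\|(f(x)-a)\,w_1(x)\|_{L^1(\Omega)}\le C\,\|\nabla f(x)\,d(x)\,w_2(x)\|_{L^1(\Omega)}$$ for all locally Lipschitz functions $f$ on $\Omega$.
   Context: For a domain $\Omega\subset\mathbb{R}^n$ and $x\in\Omega$, $d(x)$ denotes the distance from $x$ to the boundary $\partial\Omega$. A bounded domain $\Omega\subset\mathbb{R}^n$ is a John domain if, for a fixed $x_0\in\Omega$, there exist constants $\delta>0$ and $K_0<\infty$, depending only on $\Omega$ and $x_0$, such that for every $y\in\Omega$ there is a rectifiable curve $\gamma(\cdot,y):[0,1]\to\Omega$ with $\gamma(0,y)=y$, $\gamma(1,y)=x_0$, $d(\gamma(s,y))\ge\delta s$ and $|\dot\gamma(s,y)|\le K_0$, where $\dot\gamma(s,y)=\frac{\partial\gamma}{\partial s}(s,y)$. $M$ denotes the Hardy-Littlewood maximal function on $\mathbb{R}^n$. The gradient of a locally Lipschitz function exists almost everywhere. The right-hand side of the conclusion may be $+\infty$, in which case the inequality is trivial. *)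

theory Defs
  imports "HOL-Analysis.Analysis"
begin

definition boundary_dist :: "'a::euclidean_space set \<Rightarrow> 'a \<Rightarrow> real" where
  "boundary_dist \<Omega> x = infdist x (frontier \<Omega>)"

definition rectifiable_curve :: "(real \<Rightarrow> 'a::euclidean_space) \<Rightarrow> bool" where
  "rectifiable_curve \<gamma> \<longleftrightarrow> path \<gamma> \<and>
     (\<exists>B. \<forall>(m::nat) t. (\<forall>i\<le>m. t i \<in> {0..1}) \<and> (\<forall>i<m. t i \<le> t (Suc i)) \<longrightarrow>
        (\<Sum>i<m. dist (\<gamma> (t i)) (\<gamma> (t (Suc i)))) \<le> B)"

definition absolutely_continuous_curve :: "(real \<Rightarrow> 'a::euclidean_space) \<Rightarrow> bool" where
  "absolutely_continuous_curve \<gamma> \<longleftrightarrow>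
     (\<forall>\<epsilon>>0. \<exists>\<eta>>0. \<forall>(m::nat) a b.
        (\<forall>i<m. 0 \<le> a i \<and> a i \<le> b i \<and> b i \<le> 1) \<and>
        disjoint_family_on (\<lambda>i. {a i<..<b i}) {..<m} \<and>
        (\<Sum>i<m. b i - a i) < \<eta> \<longrightarrow>
        (\<Sum>i<m. dist (\<gamma> (a i)) (\<gamma> (b i))) < \<epsilon>)"

(* The velocity of a rectifiable curve exists only almost everywhere, so the speed bound is
   imposed almost everywhere. For it to control the curve, the parametrization has to be
   absolutely continuous: otherwise one could reparametrize by a Cantor-type function, with
   zero velocity almost everywhere, and the speed bound would say nothing. *)
definition john_domain :: "'a::euclidean_space set \<Rightarrow> bool" where
  "john_domain \<Omega> \<longleftrightarrow> open \<Omega> \<and> connected \<Omega> \<and> \<Omega> \<noteq> {} \<and> bounded \<Omega> \<and>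
     (\<exists>x0\<in>\<Omega>. \<exists>\<delta>>0. \<exists>K0::real. \<forall>y\<in>\<Omega>. \<exists>\<gamma>.
        rectifiable_curve \<gamma> \<and> absolutely_continuous_curve \<gamma> \<and> path_image \<gamma> \<subseteq> \<Omega> \<and>
        \<gamma> 0 = y \<and> \<gamma> 1 = x0 \<and>
        (\<forall>s\<in>{0..1}. \<delta> * s \<le> boundary_dist \<Omega> (\<gamma> s)) \<and>
        (AE s\<in>{0..1} in lebesgue.
           \<exists>v. (\<gamma> has_vector_derivative v) (at s within {0..1}) \<and> norm v \<le> K0))"

definition maximal_function ::
  "('a::euclidean_space \<Rightarrow> 'b::real_normed_vector) \<Rightarrow> 'a \<Rightarrow> ennreal" where
  "maximal_function g x =
     (SUP r\<in>{0<..}. (\<integral>\<^sup>+ y\<in>ball x r. ennreal (norm (g y)) \<partial>lebesgue)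
                       / emeasure lebesgue (ball x r))"

definition locally_lipschitz_on :: "'a::metric_space set \<Rightarrow> ('a \<Rightarrow> 'b::metric_space) \<Rightarrow> bool" where
  "locally_lipschitz_on \<Omega> f \<longleftrightarrow>
     (\<forall>x\<in>\<Omega>. \<exists>r>0. \<exists>L. L-lipschitz_on (ball x r \<inter> \<Omega>) f)"

(* Unspecified at points where f is not differentiable. *)
definition gradient :: "('a::euclidean_space \<Rightarrow> real) \<Rightarrow> 'a \<Rightarrow> 'a" where
  "gradient f x = (THE D. GDERIV f x :> D)"

(* Takes the value \<infinity> when g is not integrable on A. *)
definition L1_norm_on :: "'a::euclidean_space set \<Rightarrow> ('a \<Rightarrow> 'b::real_normed_vector) \<Rightarrow> ennreal" where
  "L1_norm_on A g = (\<integral>\<^sup>+ x\<in>A. ennreal (norm (g x)) \<partial>lebesgue)"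

end

theory Submission
  imports Defs
begin

text \<open>
  Let \<open>\<gamma>\<close> be the curve from \<open>y\<close> to \<open>x0\<close> and \<open>\<rho> = \<delta>/2\<close>. For \<open>norm z < \<rho>\<close> the tilted curve \<open>s \<mapsto> \<gamma> s + s z\<close> stays in
  \<open>\<Omega>\<close> and joins \<open>y\<close> to \<open>x0 + z\<close>, so \<open>\<bar>f y - f (x0 + z)\<bar>\<close> is at most \<open>K + \<rho>\<close> times the integral of \<open>norm (\<nabla>f)\<close>
  over it. Averaging over \<open>z\<close> and substituting \<open>x = \<gamma> s + s z\<close> gives
  \<open>\<integral>\<integral> s\<^sup>-\<^sup>n norm (\<nabla>f x) ds dx\<close> over \<open>\<rho> s \<le> d x\<close>, \<open>norm (x - y) < (K + \<rho>) s\<close>: a region that no longer mentions \<open>\<gamma>\<close>.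
  Integrating in \<open>y\<close> against \<open>w1\<close> first, each \<open>s\<close> contributes at most a multiple of the maximal function at \<open>x\<close>, and
  the remaining integral over \<open>s \<le> d x / \<rho>\<close> produces the factor \<open>d x\<close>. The infimum over \<open>a\<close> is bounded by the
  average over the values \<open>a = f (x0 + z)\<close>, so no mean value of \<open>f\<close> has to be formed.

  The analytic input is the fundamental theorem of calculus for absolutely continuous curves, read off from
  the gauge integral, and Rademacher's theorem: one-dimensional Lipschitz functions are differentiable almost
  everywhere by Vitali covering, Fubini transfers this to every fixed direction, directional derivatives are
  additive almost everywhere because their integrals over boxes are, and countably many directions suffice.
\<close>

subsection \<open>Differentiability of Lipschitz functions on the line\<close>

text \<open>Small-quotient intervals inside an open set barely larger than \<open>E\<close> form a
  Vitali cover of \<open>E\<close>, so countably many disjoint ones cover \<open>E\<close> up to a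
  null set. Monotonicity keeps their images disjoint, with total length at most \<open>p\<close>
  times the measure of the open set; the Lipschitz bound keeps the image of the leftover null set
  null.\<close>

lemma emeasure_image_le_of_small_quotients:
  fixes k :: "real \<Rightarrow> real"
  assumes mono: "strict_mono k" and lip: "L-lipschitz_on UNIV k"
    and E: "E \<in> sets lebesgue" and kE: "k ` E \<in> sets lebesgue" and "0 \<le> p"
    and quot: "\<And>x d. \<lbrakk>x \<in> E; 0 < d\<rbrakk> \<Longrightarrow>
      \<exists>u v. u < v \<and> u \<le> x \<and> x \<le> v \<and> v - u < d \<and> k v - k u \<le> p * (v - u)"
  shows "emeasure lebesgue (k ` E) \<le> ennreal p * emeasure lebesgue E"
proof -
  have "emeasure lebesgue (k ` E) \<le> ennreal p * (emeasure lebesgue E + ennreal e)" if "e > 0" for e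
  proof -
    obtain U where U: "open U" "E \<subseteq> U" "U - E \<in> lmeasurable" "emeasure lebesgue (U - E) < ennreal e"
      using sets_lebesgue_outer_open[OF E \<open>e > 0\<close>] by metis
    have mU: "emeasure lebesgue U \<le> emeasure lebesgue E + ennreal e"
    proof -
      have "emeasure lebesgue U = emeasure lebesgue (E \<union> (U - E))"
        using U(2) by (intro arg_cong[where f="emeasure lebesgue"]) auto
      also have "\<dots> \<le> emeasure lebesgue E + emeasure lebesgue (U - E)"
        using E U(3) by (intro emeasure_subadditive) auto
      also have "\<dots> \<le> emeasure lebesgue E + ennreal e"
        using U(4) by (intro add_mono) auto
      finally show ?thesis .
    qed
    define K where "K = {(u, v). u < v \<and> {u..v} \<subseteq> U \<and> k v - k u \<le> p * (v - u)}"
    \<comment> \<open>The Vitali theorem is applied to closed balls, so an interval is encoded by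
      its midpoint and half its length.\<close>
    define c r :: "real \<times> real \<Rightarrow> real" where "c = (\<lambda>(u, v). (u + v) / 2)" and "r = (\<lambda>(u, v). (v - u) / 2)"
    have cb: "cball (c i) (r i) = {fst i..snd i}" for i
      by (cases i) (auto simp: c_def r_def cball_eq_atLeastAtMost field_simps)
    have r_pos: "0 < r i" if "i \<in> K" for i
      using that by (auto simp: K_def r_def)
    have cover: "\<exists>i. i \<in> K \<and> x \<in> cball (c i) (r i) \<and> r i < d" if "x \<in> E" "0 < d" for x d
    proof -
      obtain d' where d': "d' > 0" "ball x d' \<subseteq> U"
        using U(1,2) \<open>x \<in> E\<close> openE by blast
      obtain u v where uv: "u < v" "u \<le> x" "x \<le> v" "v - u < min d d'" "k v - k u \<le> p * (v - u)"
        using quot[OF \<open>x \<in> E\<close>, of "min d d'"] d'(1) \<open>0 < d\<close> by (metis min_less_iff_conj)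
      have "{u..v} \<subseteq> ball x d'"
        using uv by (auto simp: dist_real_def)
      then have "(u, v) \<in> K"
        using uv d'(2) by (auto simp: K_def)
      moreover have "x \<in> cball (c (u, v)) (r (u, v))"
        using uv by (simp add: cb)
      moreover have "r (u, v) < d"
        using uv by (simp add: r_def)
      ultimately show ?thesis by blast
    qed
    obtain C where C: "countable C" "C \<subseteq> K"
      "pairwise (\<lambda>i j. disjnt (cball (c i) (r i)) (cball (c j) (r j))) C"
      "negligible (E - (\<Union>i\<in>C. cball (c i) (r i)))"
      using Vitali_covering_theorem_cballs[of K r E c, OF r_pos cover] by blast
    have disj: "disjoint_family_on (\<lambda>i. {fst i..snd i}) C"
      using C(3) by (auto simp: disjoint_family_on_def pairwise_def disjnt_def cb)
    have disj': "disjoint_family_on (\<lambda>i. {k (fst i)..k (snd i)}) C"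
    proof (unfold disjoint_family_on_def, intro ballI impI)
      fix i j assume ij: "i \<in> C" "j \<in> C" "i \<noteq> j"
      then have *: "{fst i..snd i} \<inter> {fst j..snd j} = {}" and lt: "fst i < snd i" "fst j < snd j"
        using disj C(2) by (auto simp: disjoint_family_on_def K_def)
      then have "snd i < fst j \<or> snd j < fst i"
        by (auto simp: Int_atLeastAtMost max_def min_def not_le split: if_splits)
      then have "k (snd i) < k (fst j) \<or> k (snd j) < k (fst i)"
        using mono by (auto simp: strict_mono_less)
      then show "{k (fst i)..k (snd i)} \<inter> {k (fst j)..k (snd j)} = {}"
        by auto
    qed
    have neg: "negligible (k ` (E - (\<Union>i\<in>C. cball (c i) (r i))))"
    proof (rule negligible_locally_Lipschitz_image[OF _ C(4)])
      fix x assume "x \<in> E - (\<Union>i\<in>C. cball (c i) (r i))"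
      show "\<exists>T B. open T \<and> x \<in> T \<and>
          (\<forall>y\<in>(E - (\<Union>i\<in>C. cball (c i) (r i))) \<inter> T. norm (k y - k x) \<le> B * norm (y - x))"
        using lipschitz_onD[OF lip] by (intro exI[of _ UNIV] exI[of _ L]) (auto simp: dist_norm)
    qed simp
    have sub: "k ` E \<subseteq> k ` (E - (\<Union>i\<in>C. cball (c i) (r i))) \<union> (\<Union>i\<in>C. {k (fst i)..k (snd i)})"
      using mono by (fastforce simp: cb strict_mono_less_eq)
    have UN_sets: "(\<Union>i\<in>C. {k (fst i)..k (snd i)}) \<in> sets lebesgue"
      using C(1) by (intro sets.countable_UN') auto
    have "emeasure lebesgue (k ` E) \<le>
        emeasure lebesgue (k ` (E - (\<Union>i\<in>C. cball (c i) (r i))) \<union> (\<Union>i\<in>C. {k (fst i)..k (snd i)}))"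
      using neg UN_sets by (intro emeasure_mono[OF sub] sets.Un) (auto intro: negligible_imp_sets)
    also have "\<dots> \<le> emeasure lebesgue (k ` (E - (\<Union>i\<in>C. cball (c i) (r i))))
        + emeasure lebesgue (\<Union>i\<in>C. {k (fst i)..k (snd i)})"
      using neg UN_sets by (intro emeasure_subadditive) (auto intro: negligible_imp_sets)
    also have "emeasure lebesgue (k ` (E - (\<Union>i\<in>C. cball (c i) (r i)))) = 0"
      using neg by (simp add: negligible_iff_null_sets null_setsD1)
    also have "emeasure lebesgue (\<Union>i\<in>C. {k (fst i)..k (snd i)})
        = (\<integral>\<^sup>+i. emeasure lebesgue {k (fst i)..k (snd i)} \<partial>count_space C)"
      using C(1) disj' by (intro emeasure_UN_countable) auto
    also have "\<dots> \<le> (\<integral>\<^sup>+i. ennreal p * emeasure lebesgue {fst i..snd i} \<partial>count_space C)"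
    proof (intro nn_integral_mono)
      fix i assume "i \<in> space (count_space C)"
      then have i: "fst i < snd i" "k (snd i) - k (fst i) \<le> p * (snd i - fst i)"
        using C(2) by (auto simp: K_def)
      then have "k (fst i) \<le> k (snd i)"
        using mono by (simp add: strict_mono_less_eq)
      with i \<open>0 \<le> p\<close> show "emeasure lebesgue {k (fst i)..k (snd i)} \<le> ennreal p * emeasure lebesgue {fst i..snd i}"
        by (simp add: ennreal_mult'[symmetric] ennreal_leI)
    qed
    also have "\<dots> = ennreal p * (\<integral>\<^sup>+i. emeasure lebesgue {fst i..snd i} \<partial>count_space C)"
      by (simp add: nn_integral_cmult)
    also have "(\<integral>\<^sup>+i. emeasure lebesgue {fst i..snd i} \<partial>count_space C) = emeasure lebesgue (\<Union>i\<in>C. {fst i..snd i})"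
      using C(1) disj by (intro emeasure_UN_countable[symmetric]) auto
    also have "\<dots> \<le> emeasure lebesgue U"
      using C(2) U(1) by (intro emeasure_mono UN_least) (auto simp: K_def case_prod_beta dest!: subsetD)
    also note mU
    finally show ?thesis by (simp add: mult_left_mono)
  qed
  note * = this
  show ?thesis
  proof (rule ennreal_le_epsilon)
    fix e :: real assume "0 < e"
    show "emeasure lebesgue (k ` E) \<le> ennreal p * emeasure lebesgue E + ennreal e"
    \<comment> \<open>For \<open>p = 0\<close> the factor absorbs the excess of the open set;
      otherwise the excess is taken to be \<open>e / p\<close>, which \<open>p\<close> turns into
      \<open>e\<close>.\<close>
    proof (cases "p = 0")
      case True
      then show ?thesis using *[of 1] by simp
    next
      case False
      with \<open>0 \<le> p\<close> have "p > 0" by simp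
      then show ?thesis
        using *[of "e / p"] \<open>0 < e\<close> by (simp add: distrib_left ennreal_mult'[symmetric])
    qed
  qed
qed

text \<open>Along \<open>v\<close> the lower derivative of \<open>f\<close> is at most \<open>p\<close> and the upper one at least \<open>q\<close>. For \<open>p < q\<close> a point of this
  set is a point of non-differentiability.\<close>
definition osc :: "('a::real_normed_vector \<Rightarrow> real) \<Rightarrow> 'a \<Rightarrow> real \<Rightarrow> real \<Rightarrow> 'a set" where
  "osc f v p q = {x. \<forall>n. (\<exists>t. t \<noteq> 0 \<and> \<bar>t\<bar> < 1 / Suc n \<and> (f (x + t *\<^sub>R v) - f x) / t < p)
                       \<and> (\<exists>t. t \<noteq> 0 \<and> \<bar>t\<bar> < 1 / Suc n \<and> q < (f (x + t *\<^sub>R v) - f x) / t)}"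

lemma osc_lessE:
  assumes "x \<in> osc f v p q" "0 < d"
  obtains t where "t \<noteq> 0" "\<bar>t\<bar> < d" "(f (x + t *\<^sub>R v) - f x) / t < p"
proof -
  obtain n where n: "1 / Suc n < d" using nat_approx_posE[OF assms(2)] by blast
  obtain t where "t \<noteq> 0" "\<bar>t\<bar> < 1 / Suc n" "(f (x + t *\<^sub>R v) - f x) / t < p"
    using assms(1) unfolding osc_def by blast
  with n show ?thesis by (intro that) auto
qed

lemma osc_greaterE:
  assumes "x \<in> osc f v p q" "0 < d"
  obtains t where "t \<noteq> 0" "\<bar>t\<bar> < d" "q < (f (x + t *\<^sub>R v) - f x) / t"
proof -
  obtain n where n: "1 / Suc n < d" using nat_approx_posE[OF assms(2)] by blast
  obtain t where "t \<noteq> 0" "\<bar>t\<bar> < 1 / Suc n" "q < (f (x + t *\<^sub>R v) - f x) / t"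
    using assms(1) unfolding osc_def by blast
  with n show ?thesis by (intro that) auto
qed

text \<open>For fixed nonzero \<open>t\<close> the quotient is continuous in \<open>x\<close>, so
  each existential condition defines an open set, however many \<open>t\<close> enter the union. The
  whole set is a countable intersection of open sets.\<close>

lemma borel_osc:
  fixes f :: "'a::euclidean_space \<Rightarrow> real"
  assumes f: "continuous_on UNIV f"
  shows "osc f v p q \<in> sets borel"
proof -
  have c: "continuous_on UNIV (\<lambda>x. (f (x + t *\<^sub>R v) - f x) / t)" if "t \<noteq> 0" for t
    using that by (intro continuous_intros continuous_on_compose2[OF f]) auto
  have eq: "osc f v p q = (\<Inter>n. (\<Union>t\<in>{t. t \<noteq> 0 \<and> \<bar>t\<bar> < 1 / Suc n}. {x. (f (x + t *\<^sub>R v) - f x) / t < p})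
      \<inter> (\<Union>t\<in>{t. t \<noteq> 0 \<and> \<bar>t\<bar> < 1 / Suc n}. {x. q < (f (x + t *\<^sub>R v) - f x) / t}))"
    unfolding osc_def by blast
  have "open (\<Union>t\<in>{t. t \<noteq> 0 \<and> \<bar>t\<bar> < 1 / Suc n}. {x. (f (x + t *\<^sub>R v) - f x) / t < p})"
    "open (\<Union>t\<in>{t. t \<noteq> 0 \<and> \<bar>t\<bar> < 1 / Suc n}. {x. q < (f (x + t *\<^sub>R v) - f x) / t})" for n :: nat
    by (intro open_UN ballI open_Collect_less continuous_intros c; simp)+
  then show ?thesis
    unfolding eq by (intro sets.countable_INT sets.Int) auto
qed

text \<open>Vitali covering gives \<open>\<mu>(k ` E) \<le> p \<mu>(E)\<close>; applied to the inverse of \<open>k\<close> it also gives \<open>q \<mu>(E) \<le> \<mu>(k ` E)\<close>.\<close>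
lemma negligible_osc_expanding:
  fixes k :: "real \<Rightarrow> real"
  assumes lip: "L-lipschitz_on UNIV k" and exp: "\<And>x y. x \<le> y \<Longrightarrow> y - x \<le> k y - k x" and "p < q"
  shows "negligible (osc k 1 p q)"
proof -
  have mono: "strict_mono k"
  proof (rule strict_monoI)
    fix x y :: real assume "x < y"
    then show "k x < k y" using exp[of x y] by linarith
  qed
  have cont: "continuous_on UNIV k"
    using lip by (rule lipschitz_on_continuous_on)
  have "\<exists>x. k x = y" for y
  proof -
    let ?M = "\<bar>y - k 0\<bar>"
    have "k (- ?M) \<le> y" "y \<le> k ?M"
      using exp[of "- ?M" 0] exp[of 0 ?M] by auto
    then show ?thesis
      using IVT'[of k "- ?M" y ?M] continuous_on_subset[OF cont] by auto
  qed
  then have "surj k" by (metis surjI)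
  have "inj k" using mono by (rule strict_mono_imp_inj_on)
  define j where "j = inv k"
  have jk: "j (k x) = x" and kj: "k (j x) = x" for x
    using \<open>surj k\<close> \<open>inj k\<close> by (auto simp: j_def surj_f_inv_f)
  have j_lip: "1-lipschitz_on UNIV j"
  proof (rule lipschitz_onI)
    fix x y :: real
    show "dist (j x) (j y) \<le> 1 * dist x y"
      using exp[of "j x" "j y"] exp[of "j y" "j x"] by (auto simp: kj dist_real_def abs_if)
  qed simp
  have j_mono: "strict_mono j"
    using mono by (intro strict_monoI) (metis kj strict_mono_less)
  have image_j: "k ` E = j -` E" for E
    using jk kj by (auto simp: image_iff) (metis kj)+
  \<comment> \<open>Cutting down to a bounded interval makes the measure of \<open>E\<close> finite;
    only then does bounding it by \<open>p / q\<close> times itself force it to vanish.\<close>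
  have "negligible (osc k 1 p q \<inter> {- real m..real m})" for m :: nat
  proof (cases "osc k 1 p q \<inter> {- real m..real m} = {}")
    case False
    define E where "E = osc k 1 p q \<inter> {- real m..real m}"
    have E: "E \<in> sets borel"
      unfolding E_def using borel_osc[OF cont] by auto
    obtain x0 where "x0 \<in> E" using False unfolding E_def by blast
    then obtain t where t: "t \<noteq> 0" "(k (x0 + t) - k x0) / t < p"
      unfolding E_def osc_def by auto
    \<comment> \<open>All quotients of \<open>k\<close> are at least 1, so a single point of
      \<open>E\<close> already gives \<open>p > 1\<close>, hence positivity of both bounds.\<close>
    have "1 \<le> (k (x0 + t) - k x0) / t"
      using exp[of x0 "x0 + t"] exp[of "x0 + t" x0] t(1) by (cases "t > 0") (auto simp: field_simps)
    with t \<open>p < q\<close> have pq: "0 < p" "0 < q" by auto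
    have kE: "k ` E \<in> sets borel"
      using E lipschitz_on_continuous_on[OF j_lip] measurable_sets[OF borel_measurable_continuous_onI, of j E]
      by (simp add: image_j)
    have le1: "emeasure lebesgue (k ` E) \<le> ennreal p * emeasure lebesgue E"
    proof (rule emeasure_image_le_of_small_quotients[OF mono lip])
      fix x d :: real assume "x \<in> E" "0 < d"
      then obtain t where t: "t \<noteq> 0" "\<bar>t\<bar> < d" "(k (x + t) - k x) / t < p"
        using osc_lessE[of x k 1 p q d] by (auto simp: E_def)
      then show "\<exists>u v. u < v \<and> u \<le> x \<and> x \<le> v \<and> v - u < d \<and> k v - k u \<le> p * (v - u)"
        by (intro exI[of _ "min x (x + t)"] exI[of _ "max x (x + t)"])
           (cases "t > 0"; simp add: min_def max_def field_simps)
    qed (use E kE pq in auto)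
    \<comment> \<open>The same covering estimate for the inverse: a quotient of \<open>k\<close>
      above \<open>q\<close> is a quotient of \<open>j\<close> below \<open>1 / q\<close>.\<close>
    have "emeasure lebesgue (j ` (k ` E)) \<le> ennreal (1 / q) * emeasure lebesgue (k ` E)"
    proof (rule emeasure_image_le_of_small_quotients[OF j_mono j_lip])
      fix y d :: real assume "y \<in> k ` E" "0 < d"
      then obtain x where x: "x \<in> E" "y = k x" by auto
      have "0 \<le> L" using lip by (rule lipschitz_on_nonneg)
      \<comment> \<open>The interval for \<open>j\<close> lies in the image of \<open>k\<close>, so
        its length must be controlled there: increments of \<open>k\<close> are at most
        \<open>L * \<bar>t\<bar>\<close>, and the \<open>+ 1\<close> guards against
        \<open>L = 0\<close>.\<close>
      obtain t where t: "t \<noteq> 0" "\<bar>t\<bar> < d / (L + 1)" "q < (k (x + t) - k x) / t"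
        using x(1) osc_greaterE[of x k 1 p q "d / (L + 1)"] \<open>0 < d\<close> \<open>0 \<le> L\<close> by (auto simp: E_def)
      have "\<bar>k (x + t) - k x\<bar> \<le> L * \<bar>t\<bar>"
        using lipschitz_onD[OF lip, of "x + t" x] by (auto simp: dist_real_def)
      also have "\<dots> \<le> (L + 1) * \<bar>t\<bar>" by (simp add: distrib_right)
      also have "\<dots> < d" using t(2) \<open>0 \<le> L\<close> by (simp add: field_simps)
      finally have d: "\<bar>k (x + t) - k x\<bar> < d" .
      have "k x < k (x + t) \<longleftrightarrow> 0 < t" "k (x + t) < k x \<longleftrightarrow> t < 0"
        using mono by (auto simp: strict_mono_less)
      then show "\<exists>u v. u < v \<and> u \<le> y \<and> y \<le> v \<and> v - u < d \<and> j v - j u \<le> 1 / q * (v - u)"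
        using t d pq
        by (intro exI[of _ "min y (k (x + t))"] exI[of _ "max y (k (x + t))"])
           (cases "t > 0"; simp add: min_def max_def field_simps x(2) jk)
    qed (use E kE pq in \<open>auto simp: image_image jk\<close>)
    then have le2: "emeasure lebesgue E \<le> ennreal (1 / q) * emeasure lebesgue (k ` E)"
      by (simp add: image_image jk)
    have "emeasure lebesgue E \<le> emeasure lebesgue {- real m..real m}"
      unfolding E_def by (intro emeasure_mono) auto
    then have fin: "emeasure lebesgue E < \<infinity>"
      by (simp add: le_less_trans)
    have "emeasure lebesgue E \<le> ennreal (1 / q) * (ennreal p * emeasure lebesgue E)"
      using le2 le1 by (meson mult_left_mono order_trans zero_le)
    also have "\<dots> = ennreal (p / q) * emeasure lebesgue E"
      using pq by (simp add: mult.assoc[symmetric] ennreal_mult'[symmetric])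
    finally have *: "emeasure lebesgue E \<le> ennreal (p / q) * emeasure lebesgue E" .
    obtain e where e: "emeasure lebesgue E = ennreal e" "e \<ge> 0"
      using fin by (cases "emeasure lebesgue E") auto
    have "e \<le> p / q * e"
      using * pq e by (simp add: ennreal_mult'[symmetric])
    then have "e = 0"
      using pq \<open>p < q\<close> e(2) by (smt (verit) divide_less_eq_1 mult_left_le_one_le mult_less_cancel_right2 )
    with e E show ?thesis
      unfolding E_def[symmetric] by (simp add: negligible_iff_null_sets null_setsI)
  qed simp
  moreover have "osc k 1 p q \<subseteq> (\<Union>m. osc k 1 p q \<inter> {- real m..real m})"
  proof
    fix x assume x: "x \<in> osc k 1 p q"
    obtain m :: nat where "\<bar>x\<bar> \<le> real m" using real_arch_simple by blast
    with x show "x \<in> (\<Union>m. osc k 1 p q \<inter> {- real m..real m})"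
      by (auto intro!: exI[of _ m])
  qed
  ultimately show ?thesis
    by (meson negligible_subset negligible_Union_nat)
qed

text \<open>Adding \<open>(L + 1) * x\<close> outweighs any decrease of \<open>h\<close>, which
  makes the function expanding, and shifts every difference quotient by exactly
  \<open>L + 1\<close>.\<close>

lemma negligible_osc_real:
  fixes h :: "real \<Rightarrow> real"
  assumes lip: "L-lipschitz_on UNIV h" and "p < q"
  shows "negligible (osc h 1 p q)"
proof -
  define k where "k = (\<lambda>x. h x + (L + 1) * x)"
  have "0 \<le> L" using lip by (rule lipschitz_on_nonneg)
  have "(L + \<bar>L + 1\<bar> * 1)-lipschitz_on UNIV k"
    unfolding k_def by (intro lipschitz_intros lip)
  moreover have "y - x \<le> k y - k x" if "x \<le> y" for x y
    using lipschitz_onD[OF lip, of x y] that by (simp add: k_def dist_real_def algebra_simps)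
  ultimately have "negligible (osc k 1 (p + (L + 1)) (q + (L + 1)))"
    using \<open>p < q\<close> by (intro negligible_osc_expanding) auto
  moreover have "osc k 1 (p + (L + 1)) (q + (L + 1)) = osc h 1 p q"
  proof -
    have "(k (x + t) - k x) / t = (h (x + t) - h x) / t + (L + 1)" if "t \<noteq> 0" for x t
      using that by (simp add: k_def field_simps)
    then have "t \<noteq> 0 \<Longrightarrow> ((k (x + t) - k x) / t < p + (L + 1)) = ((h (x + t) - h x) / t < p)"
      "t \<noteq> 0 \<Longrightarrow> (q + (L + 1) < (k (x + t) - k x) / t) = (q < (h (x + t) - h x) / t)" for x t
      by auto
    then show ?thesis
      by (simp add: osc_def cong: conj_cong)
  qed
  ultimately show ?thesis by simp
qed

subsection \<open>Rademacher's theorem\<close>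

text \<open>If the lower and upper limits of the quotients differed, two rationals would fit between
  them and \<open>x\<close> would lie in the corresponding \<open>osc\<close> set. The Lipschitz
  bound keeps the common value finite. Rational bounds leave only countably many exceptional
  sets.\<close>

lemma exists_limit_of_no_oscillation:
  fixes f :: "'a::euclidean_space \<Rightarrow> real"
  assumes lip: "L-lipschitz_on UNIV f"
    and no: "\<And>p q. \<lbrakk>p \<in> \<rat>; q \<in> \<rat>; p < q\<rbrakk> \<Longrightarrow> x \<notin> osc f v p q"
  shows "\<exists>l. ((\<lambda>t. (f (x + t *\<^sub>R v) - f x) / t) \<longlongrightarrow> l) (at 0)"
proof -
  define Q where "Q = (\<lambda>t. (f (x + t *\<^sub>R v) - f x) / t)"
  have bound: "\<bar>Q t\<bar> \<le> L * norm v" if "t \<noteq> 0" for t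
    using lipschitz_onD[OF lip, of "x + t *\<^sub>R v" x] that
    by (simp add: Q_def dist_norm field_simps)
  let ?i = "Liminf (at 0) (\<lambda>t. ereal (Q t))" and ?s = "Limsup (at 0) (\<lambda>t. ereal (Q t))"
  have "?i = ?s"
  proof (rule ccontr)
    assume "?i \<noteq> ?s"
    then have "?i < ?s"
      using Liminf_le_Limsup[of "at (0::real)" "\<lambda>t. ereal (Q t)"] by (simp add: order_less_le)
    obtain p where p: "?i < ereal (real_of_rat p)" "ereal (real_of_rat p) < ?s"
      using ereal_dense3[OF \<open>?i < ?s\<close>] by (elim exE conjE) (rule that)
    obtain q where q: "ereal (real_of_rat p) < ereal (real_of_rat q)" "ereal (real_of_rat q) < ?s"
      using ereal_dense3[OF p(2)] by (elim exE conjE) (rule that)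
    have "x \<notin> osc f v (real_of_rat p) (real_of_rat q)"
      using q(1) by (intro no) auto
    then obtain n where "\<not> ((\<exists>t. t \<noteq> 0 \<and> \<bar>t\<bar> < 1 / Suc n \<and> Q t < real_of_rat p)
        \<and> (\<exists>t. t \<noteq> 0 \<and> \<bar>t\<bar> < 1 / Suc n \<and> real_of_rat q < Q t))"
      unfolding osc_def mem_Collect_eq not_all Q_def
      by (elim exE) (rule that, unfold Q_def, assumption)
    then have "(\<forall>t. t \<noteq> 0 \<and> \<bar>t\<bar> < 1 / Suc n \<longrightarrow> real_of_rat p \<le> Q t)
       \<or> (\<forall>t. t \<noteq> 0 \<and> \<bar>t\<bar> < 1 / Suc n \<longrightarrow> Q t \<le> real_of_rat q)"
      by (meson not_less)
    then have "eventually (\<lambda>t. real_of_rat p \<le> Q t) (at 0) \<or> eventually (\<lambda>t. Q t \<le> real_of_rat q) (at 0)"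
    proof (elim disj_forward)
      assume "\<forall>t. t \<noteq> 0 \<and> \<bar>t\<bar> < 1 / Suc n \<longrightarrow> real_of_rat p \<le> Q t"
      then show "eventually (\<lambda>t. real_of_rat p \<le> Q t) (at 0)"
        unfolding eventually_at by (intro exI[of _ "1 / real (Suc n)"]) (auto simp: dist_real_def)
    next
      assume "\<forall>t. t \<noteq> 0 \<and> \<bar>t\<bar> < 1 / Suc n \<longrightarrow> Q t \<le> real_of_rat q"
      then show "eventually (\<lambda>t. Q t \<le> real_of_rat q) (at 0)"
        unfolding eventually_at by (intro exI[of _ "1 / real (Suc n)"]) (auto simp: dist_real_def)
    qed
    then show False
    proof
      assume "eventually (\<lambda>t. real_of_rat p \<le> Q t) (at 0)"
      then have "ereal (real_of_rat p) \<le> ?i"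
        by (intro Liminf_bounded) (auto elim: eventually_mono)
      with p(1) show False by simp
    next
      assume "eventually (\<lambda>t. Q t \<le> real_of_rat q) (at 0)"
      then have "?s \<le> ereal (real_of_rat q)"
        by (intro Limsup_bounded) (auto elim: eventually_mono)
      with q(2) show False by simp
    qed
  qed
  have "eventually (\<lambda>t. \<bar>Q t\<bar> \<le> L * norm v) (at 0)"
    unfolding eventually_at using bound by (intro exI[of _ 1]) auto
  then have bounds: "ereal (- (L * norm v)) \<le> ?i" "?s \<le> ereal (L * norm v)"
    by (intro Liminf_bounded Limsup_bounded; force elim: eventually_mono)+
  obtain l where "?s = ereal l"
    using bounds \<open>?i = ?s\<close> by (cases ?s) auto
  with \<open>?i = ?s\<close> have "((\<lambda>t. ereal (Q t)) \<longlongrightarrow> ereal l) (at 0)"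
    by (intro Liminf_eq_Limsup) auto
  then show ?thesis
    by (auto simp: Q_def)
qed

section \<open>Existence of directional derivatives almost everywhere\<close>

lemma nn_integral_lborel_translate:
  fixes c :: "'a::euclidean_space"
  assumes [measurable]: "g \<in> borel_measurable borel"
  shows "(\<integral>\<^sup>+x. g (x + c) \<partial>lborel) = (\<integral>\<^sup>+x. g x \<partial>lborel)"
proof -
  have "(\<integral>\<^sup>+x. g x \<partial>lborel) = (\<integral>\<^sup>+x. g x \<partial>distr lborel borel ((+) c))"
    by (simp add: lborel_distr_plus)
  also have "\<dots> = (\<integral>\<^sup>+x. g (x + c) \<partial>lborel)"
    by (subst nn_integral_distr) (simp_all add: add.commute)
  finally show ?thesis ..
qed

text \<open>Translation along \<open>v\<close> preserves the measure of \<open>S\<close>, so it may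
  be averaged over translates by \<open>t\<close> in \<open>{0..1}\<close>. After exchanging the
  integrals, the inner one measures the part of \<open>S\<close> on a single line.\<close>

lemma emeasure_zero_of_null_on_lines:
  fixes S :: "'a::euclidean_space set"
  assumes [measurable]: "S \<in> sets borel" and null: "\<And>x. negligible {t::real. x + t *\<^sub>R v \<in> S}"
  shows "emeasure lborel S = 0"
proof -
  have "emeasure lborel S = (\<integral>\<^sup>+t. emeasure lborel S * indicator {0..1::real} t \<partial>lborel)"
    by (simp add: nn_integral_cmult_indicator)
  also have "\<dots> = (\<integral>\<^sup>+t. (\<integral>\<^sup>+x. indicator S (x + t *\<^sub>R v) * indicator {0..1} t \<partial>lborel) \<partial>lborel)"
  proof (rule nn_integral_cong)
    fix t :: real
    have "emeasure lborel S = (\<integral>\<^sup>+x. indicator S x \<partial>lborel)" by simp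
    also have "\<dots> = (\<integral>\<^sup>+x. indicator S (x + t *\<^sub>R v) \<partial>lborel)"
      by (rule nn_integral_lborel_translate[symmetric]) simp
    finally show "emeasure lborel S * indicator {0..1} t
        = (\<integral>\<^sup>+x. indicator S (x + t *\<^sub>R v) * indicator {0..1} t \<partial>lborel)"
      by (simp add: nn_integral_multc)
  qed
  also have "\<dots> = (\<integral>\<^sup>+x. (\<integral>\<^sup>+t. indicator S (x + t *\<^sub>R v) * indicator {0..1} t \<partial>lborel) \<partial>lborel)"
    by (rule lborel_pair.Fubini') measurable
  also have "\<dots> = (\<integral>\<^sup>+(x::'a). 0 \<partial>lborel)"
  proof (rule nn_integral_cong)
    fix x :: 'a
    have "{t. x + t *\<^sub>R v \<in> S} \<in> null_sets lebesgue"
      using null[of x] by (simp add: negligible_iff_null_sets)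
    moreover have "{t. x + t *\<^sub>R v \<in> S} \<in> sets borel"
      by measurable
    ultimately have "{t. x + t *\<^sub>R v \<in> S} \<in> null_sets lborel"
      by (simp add: null_sets_completion_iff)
    then have "AE t in lborel. x + t *\<^sub>R v \<notin> S"
      by (auto dest: AE_not_in)
    then have "AE t in lborel. indicator S (x + t *\<^sub>R v) * indicator {0..1} t = (0::ennreal)"
      by eventually_elim simp
    then show "(\<integral>\<^sup>+t. indicator S (x + t *\<^sub>R v) * indicator {0..1} t \<partial>lborel) = (0::ennreal)"
      by (subst nn_integral_0_iff_AE) auto
  qed
  finally show ?thesis by simp
qed

text \<open>A sequential limit, so that it is Borel measurable in \<open>x\<close>; unspecified where the sequence diverges.\<close>
definition dir_deriv :: "('a::euclidean_space \<Rightarrow> real) \<Rightarrow> 'a \<Rightarrow> 'a \<Rightarrow> real" where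
  "dir_deriv f v x = lim (\<lambda>n. (f (x + (1 / Suc n) *\<^sub>R v) - f x) / (1 / Suc n))"

lemma borel_measurable_dir_deriv [measurable]:
  assumes [measurable]: "f \<in> borel_measurable borel"
  shows "dir_deriv f v \<in> borel_measurable borel"
  unfolding dir_deriv_def by measurable

lemma dir_deriv_LIMSEQ:
  assumes "((\<lambda>t. (f (x + t *\<^sub>R v) - f x) / t) \<longlongrightarrow> l) (at 0)"
  shows "(\<lambda>n. (f (x + (1 / Suc n) *\<^sub>R v) - f x) / (1 / Suc n)) \<longlonglongrightarrow> l"
proof -
  have "filterlim (\<lambda>n. 1 / real (Suc n)) (at 0) sequentially"
    using LIMSEQ_inverse_real_of_nat by (auto simp: filterlim_at inverse_eq_divide)
  from filterlim_compose[OF assms this] show ?thesis .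
qed

lemma dir_deriv_eqI:
  assumes "((\<lambda>t. (f (x + t *\<^sub>R v) - f x) / t) \<longlongrightarrow> l) (at 0)"
  shows "dir_deriv f v x = l"
  unfolding dir_deriv_def using dir_deriv_LIMSEQ[OF assms] by (rule limI)

text \<open>On a line parallel to \<open>v\<close> the oscillation set of \<open>f\<close> is the
  oscillation set of a Lipschitz function of one variable, hence null. It is therefore null in
  space, and countably many rational pairs cover all failures of convergence.\<close>

lemma AE_tendsto_dir_deriv:
  fixes f :: "'a::euclidean_space \<Rightarrow> real"
  assumes lip: "L-lipschitz_on UNIV f"
  shows "AE x in lborel. ((\<lambda>t. (f (x + t *\<^sub>R v) - f x) / t) \<longlongrightarrow> dir_deriv f v x) (at 0)"
proof -
  have cont: "continuous_on UNIV f"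
    using lip by (rule lipschitz_on_continuous_on)
  have "AE x in lborel. x \<notin> osc f v p q" if "p < q" for p q
  proof -
    have "emeasure lborel (osc f v p q) = 0"
    proof (rule emeasure_zero_of_null_on_lines[OF borel_osc[OF cont]])
      fix x
      have "{t. x + t *\<^sub>R v \<in> osc f v p q} = osc (\<lambda>t. f (x + t *\<^sub>R v)) 1 p q"
        by (simp add: osc_def scaleR_left_distrib add.assoc)
      moreover have "(L * norm v)-lipschitz_on UNIV (\<lambda>t. f (x + t *\<^sub>R v))"
      proof (rule lipschitz_onI)
        fix s t :: real
        have "dist (f (x + s *\<^sub>R v)) (f (x + t *\<^sub>R v)) \<le> L * dist (x + s *\<^sub>R v) (x + t *\<^sub>R v)"
          by (intro lipschitz_onD[OF lip]) auto
        also have "dist (x + s *\<^sub>R v) (x + t *\<^sub>R v) = norm v * dist s t"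
          by (simp add: dist_norm scaleR_left_diff_distrib[symmetric])
        finally show "dist (f (x + s *\<^sub>R v)) (f (x + t *\<^sub>R v)) \<le> L * norm v * dist s t"
          by (simp add: mult.assoc)
      qed (use lipschitz_on_nonneg[OF lip] in simp)
      ultimately show "negligible {t. x + t *\<^sub>R v \<in> osc f v p q}"
        using negligible_osc_real \<open>p < q\<close> by simp
    qed
    then show ?thesis
      by (intro AE_not_in) (simp add: null_sets_def borel_osc[OF cont])
  qed
  then have "AE x in lborel. \<forall>(p, q)\<in>{(p, q). p \<in> \<rat> \<and> q \<in> \<rat> \<and> p < q}. x \<notin> osc f v p q"
    by (intro AE_ball_countable' countable_subset[OF _ countable_SIGMA[OF countable_rat, of "\<lambda>_. \<rat>"]] countable_rat)
       (auto split: prod.splits)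
  then show ?thesis
  proof eventually_elim
    case (elim x)
    obtain l where "((\<lambda>t. (f (x + t *\<^sub>R v) - f x) / t) \<longlongrightarrow> l) (at 0)"
      using exists_limit_of_no_oscillation[OF lip, of x v] elim by auto
    then show ?case using dir_deriv_eqI by metis
  qed
qed

section \<open>Linearity of the directional derivative in the direction\<close>

text \<open>For large \<open>c'\<close> the function \<open>1 + U / c'\<close> is the density of a measure that agrees with \<open>lborel\<close> on boxes.\<close>
lemma AE_zero_of_box_integrals_zero:
  fixes U :: "'a::euclidean_space \<Rightarrow> real"
  assumes [measurable]: "U \<in> borel_measurable borel" and bound: "AE x in lborel. \<bar>U x\<bar> \<le> c"
    and zero: "\<And>l u. (\<integral>x. indicator (box l u) x * U x \<partial>lborel) = 0"
  shows "AE x in lborel. U x = 0"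
proof -
  \<comment> \<open>This makes \<open>U x / c'\<close> at most 1 in absolute value, so
    \<open>1 + U x / c'\<close> is nonnegative almost everywhere and survives the conversion to
    \<open>ennreal\<close>.\<close>
  define c' where "c' = \<bar>c\<bar> + 1"
  have "c' > 0" by (simp add: c'_def)
  have bound': "AE x in lborel. \<bar>U x / c'\<bar> \<le> 1"
    using bound by eventually_elim (auto simp: c'_def abs_divide)
  have "lborel = density lborel (\<lambda>x. ennreal (1 + U x / c'))"
  \<comment> \<open>Lebesgue measure is determined by its values on boxes, and over a box the
    contribution of \<open>U\<close> vanishes by \<open>zero\<close>.\<close>
  proof (rule lborel_eqI)
    fix l u :: 'a assume lu: "\<And>b. b \<in> Basis \<Longrightarrow> l \<bullet> b \<le> u \<bullet> b"
    have fin: "emeasure lborel (box l u) < top"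
      using emeasure_bounded_finite[OF bounded_box] by simp
    have i1: "integrable lborel (\<lambda>x. indicator (box l u) x *\<^sub>R (U x / c'))"
      using bound' fin by (intro integrableI_bounded_set_indicator[where B = 1]) (auto elim: eventually_mono)
    have i2: "integrable lborel (\<lambda>x. indicator (box l u) x :: real)"
      using fin by (intro integrable_real_indicator) auto
    have i: "integrable lborel (\<lambda>x. indicator (box l u) x * (1 + U x / c'))"
      using Bochner_Integration.integrable_add[OF i2 i1] by (simp add: distrib_left)
    have "emeasure (density lborel (\<lambda>x. ennreal (1 + U x / c'))) (box l u)
        = (\<integral>\<^sup>+x. ennreal (1 + U x / c') * indicator (box l u) x \<partial>lborel)"
      by (intro emeasure_density) auto
    also have "\<dots> = (\<integral>\<^sup>+x. ennreal (indicator (box l u) x * (1 + U x / c')) \<partial>lborel)"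
      by (intro nn_integral_cong) (simp split: split_indicator)
    also have "\<dots> = ennreal (\<integral>x. indicator (box l u) x * (1 + U x / c') \<partial>lborel)"
    proof (rule nn_integral_eq_integral[OF i])
      show "AE x in lborel. 0 \<le> indicator (box l u) x * (1 + U x / c')"
        using bound'
      proof eventually_elim
        case (elim x)
        then have "0 \<le> 1 + U x / c'" by linarith
        then show ?case by simp
      qed
    qed
    also have "(\<integral>x. indicator (box l u) x * (1 + U x / c') \<partial>lborel)
        = (\<integral>x. indicator (box l u) x \<partial>lborel) + (\<integral>x. indicator (box l u) x *\<^sub>R (U x / c') \<partial>lborel)"
      using Bochner_Integration.integral_add[OF i2 i1] by (simp add: distrib_left)
    also have "(\<integral>x. indicator (box l u) x *\<^sub>R (U x / c') \<partial>lborel) = (\<integral>x. indicator (box l u) x * U x \<partial>lborel) / c'"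
      by (subst integral_divide_zero[symmetric]) simp
    also have "\<dots> = 0" by (simp add: zero)
    also have "ennreal ((\<integral>x. indicator (box l u) x \<partial>lborel) + 0) = emeasure lborel (box l u)"
      using fin emeasure_eq_ennreal_measure[of lborel "box l u"] by (simp add: less_top)
    finally show "emeasure (density lborel (\<lambda>x. ennreal (1 + U x / c'))) (box l u) = (\<Prod>b\<in>Basis. (u - l) \<bullet> b)"
      using lu by (simp add: emeasure_lborel_box)
  qed simp
  then have "density lborel (\<lambda>x. 1) = density lborel (\<lambda>x. ennreal (1 + U x / c'))"
    by (simp add: density_1)
  \<comment> \<open>Densities of one measure with respect to a sigma-finite measure agree almost
    everywhere.\<close>
  then have "AE x in lborel. 1 = ennreal (1 + U x / c')"
    by (subst (asm) sigma_finite_measure.density_unique_iff[OF sigma_finite_lborel]) auto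
  then show ?thesis
    using bound'
  proof eventually_elim
    case (elim x)
    then have "1 = 1 + U x / c'"
      by (metis abs_le_D2 add_increasing2 diff_ge_0_iff_ge diff_minus_eq_add ennreal_1 ennreal_inj zero_le_one)
    then show ?case using \<open>c' > 0\<close> by simp
  qed
qed

lemma integral_lborel_translate:
  fixes c :: "'a::euclidean_space" and g :: "'a \<Rightarrow> real"
  assumes [measurable]: "g \<in> borel_measurable borel"
  shows "(\<integral>x. g (x + c) \<partial>lborel) = (\<integral>x. g x \<partial>lborel)"
proof -
  have "(\<integral>x. g x \<partial>lborel) = (\<integral>x. g x \<partial>distr lborel borel ((+) c))"
    by (simp add: lborel_distr_plus)
  also have "\<dots> = (\<integral>x. g (x + c) \<partial>lborel)"
    by (subst integral_distr) (simp_all add: add.commute)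
  finally show ?thesis ..
qed

lemma abs_quotient_le:
  fixes f :: "'a::euclidean_space \<Rightarrow> real"
  assumes "L-lipschitz_on UNIV f"
  shows "\<bar>(f (x + t *\<^sub>R v) - f x) / t\<bar> \<le> L * norm v"
proof (cases "t = 0")
  case False
  then show ?thesis
    using lipschitz_onD[OF assms, of "x + t *\<^sub>R v" x] by (simp add: dist_norm field_simps)
qed (use lipschitz_on_nonneg[OF assms] in simp)

lemma AE_abs_dir_deriv_le:
  fixes f :: "'a::euclidean_space \<Rightarrow> real"
  assumes lip: "L-lipschitz_on UNIV f"
  shows "AE x in lborel. \<bar>dir_deriv f v x\<bar> \<le> L * norm v"
  using AE_tendsto_dir_deriv[OF lip, of v]
proof eventually_elim
  case (elim x)
  then show ?case
    using Lim_norm_ubound[OF _ elim, of "L * norm v"] abs_quotient_le[OF lip] by simp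
qed

text \<open>The shift by \<open>w\<close> in the indicator arises when a translation is moved off
  the quotient in the additivity proof. Dominated convergence applies: off the boundary of the box
  the shifted indicators converge, and all integrands are bounded and supported in one ball.\<close>

lemma integral_box_quotient_LIMSEQ:
  fixes f :: "'a::euclidean_space \<Rightarrow> real"
  assumes lip: "L-lipschitz_on UNIV f"
  shows "(\<lambda>n. \<integral>x. indicator (box l u) (x - (1 / Suc n) *\<^sub>R w) * ((f (x + (1 / Suc n) *\<^sub>R v) - f x) / (1 / Suc n)) \<partial>lborel)
    \<longlonglongrightarrow> (\<integral>x. indicator (box l u) x * dir_deriv f v x \<partial>lborel)"
proof -
  have [measurable]: "f \<in> borel_measurable borel"
    using lipschitz_on_continuous_on[OF lip] by (rule borel_measurable_continuous_onI)
  obtain r where r: "\<And>x. x \<in> box l u \<Longrightarrow> norm x \<le> r"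
    using bounded_box[of l u] by (auto simp: bounded_iff)
  have frontier: "AE x in lborel. x \<notin> cbox l u - box l u"
    using negligible_frontier_interval[of l u]
    by (intro AE_not_in) (simp add: negligible_iff_null_sets null_sets_completion_iff)
  have 0: "(\<lambda>n. x - (1 / real (Suc n)) *\<^sub>R w) \<longlonglongrightarrow> x" for x
  proof -
    have "(\<lambda>n. x - (1 / real (Suc n)) *\<^sub>R w) \<longlonglongrightarrow> x - 0 *\<^sub>R w"
      using LIMSEQ_inverse_real_of_nat by (intro tendsto_intros) (simp add: inverse_eq_divide)
    then show ?thesis by simp
  qed
  show ?thesis
  proof (rule integral_dominated_convergence[where w = "\<lambda>x. L * norm v * indicator (cball 0 (r + norm w)) x"])
    show "AE x in lborel. (\<lambda>n. indicator (box l u) (x - (1 / real (Suc n)) *\<^sub>R w)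
          * ((f (x + (1 / real (Suc n)) *\<^sub>R v) - f x) / (1 / real (Suc n)))) \<longlonglongrightarrow> indicator (box l u) x * dir_deriv f v x"
      using AE_tendsto_dir_deriv[OF lip, of v] frontier
    proof eventually_elim
      case (elim x)
      have "(\<lambda>n. indicator (box l u) (x - (1 / real (Suc n)) *\<^sub>R w) :: real) \<longlonglongrightarrow> indicator (box l u) x"
      proof (cases "x \<in> box l u")
        case True
        then have "\<forall>\<^sub>F n in sequentially. x - (1 / real (Suc n)) *\<^sub>R w \<in> box l u"
          using topological_tendstoD[OF 0 open_box] by blast
        then show ?thesis
          by (intro tendsto_eventually) (use True in \<open>auto elim: eventually_mono\<close>)
      next
        case False
        with elim(2) have "x \<in> - cbox l u" by auto
        then have "\<forall>\<^sub>F n in sequentially. x - (1 / real (Suc n)) *\<^sub>R w \<in> - cbox l u"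
          using topological_tendstoD[OF 0] closed_cbox by blast
        then show ?thesis
          by (intro tendsto_eventually)
             (use False box_subset_cbox[of l u] in \<open>auto elim!: eventually_mono simp: indicator_def\<close>)
      qed
      then show ?case
        by (intro tendsto_mult dir_deriv_LIMSEQ elim)
    qed
  next
    fix n
    show "AE x in lborel. norm (indicator (box l u) (x - (1 / real (Suc n)) *\<^sub>R w)
          * ((f (x + (1 / real (Suc n)) *\<^sub>R v) - f x) / (1 / real (Suc n)))) \<le> L * norm v * indicator (cball 0 (r + norm w)) x"
    proof (rule AE_I2)
      fix x
      show "norm (indicator (box l u) (x - (1 / real (Suc n)) *\<^sub>R w)
          * ((f (x + (1 / real (Suc n)) *\<^sub>R v) - f x) / (1 / real (Suc n)))) \<le> L * norm v * indicator (cball 0 (r + norm w)) x"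
      proof (cases "x - (1 / real (Suc n)) *\<^sub>R w \<in> box l u")
        case True
        have "norm ((1 / real (Suc n)) *\<^sub>R w) \<le> norm w"
          by (simp add: field_simps mult_le_cancel_left1)
        then have "norm x \<le> r + norm w"
          using r[OF True] norm_triangle_sub[of x "(1 / real (Suc n)) *\<^sub>R w"] by linarith
        then show ?thesis
          using True abs_quotient_le[OF lip, of x "1 / real (Suc n)" v] by simp
      next
        case False
        then show ?thesis using lipschitz_on_nonneg[OF lip] by simp
      qed
    qed
  next
    show "integrable lborel (\<lambda>x. L * norm v * indicator (cball 0 (r + norm w)) x)"
      by (intro integrable_mult_right integrable_real_indicator)
        (use emeasure_bounded_finite[OF bounded_cball] in auto)
  qed measurable
qed

text \<open>The quotient in direction \<open>v + w\<close> at \<open>x\<close> is the quotient in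
  direction \<open>v\<close> at the point moved along \<open>w\<close>, plus the quotient in
  direction \<open>w\<close> at \<open>x\<close>. Translation invariance transfers the movement to
  the indicator of the box, so in the limit both sides have the same integral over every
  box.\<close>

lemma AE_dir_deriv_add:
  fixes f :: "'a::euclidean_space \<Rightarrow> real"
  assumes lip: "L-lipschitz_on UNIV f"
  shows "AE x in lborel. dir_deriv f (v + w) x = dir_deriv f v x + dir_deriv f w x"
proof -
  have [measurable]: "f \<in> borel_measurable borel"
    using lipschitz_on_continuous_on[OF lip] by (rule borel_measurable_continuous_onI)
  define U where "U = (\<lambda>x. dir_deriv f (v + w) x - (dir_deriv f v x + dir_deriv f w x))"
  have "AE x in lborel. U x = 0"
  proof (rule AE_zero_of_box_integrals_zero)
    show "U \<in> borel_measurable borel" unfolding U_def by measurable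
    show "AE x in lborel. \<bar>U x\<bar> \<le> L * norm (v + w) + (L * norm v + L * norm w)"
      using AE_abs_dir_deriv_le[OF lip, of "v + w"] AE_abs_dir_deriv_le[OF lip, of v]
        AE_abs_dir_deriv_le[OF lip, of w]
      by eventually_elim (simp add: U_def)
    fix l u :: 'a
    let ?B = "box l u" and ?h = "\<lambda>n. 1 / real (Suc n)"
    define q where "q = (\<lambda>v n x. (f (x + ?h n *\<^sub>R v) - f x) / ?h n)"
    have [measurable]: "q v n \<in> borel_measurable borel" for v n
      unfolding q_def by measurable
    have iB: "integrable lborel (\<lambda>x. indicator ?B x * g x)"
      if [measurable]: "g \<in> borel_measurable borel" and g: "AE x in lborel. \<bar>g x\<bar> \<le> c" for g :: "'a \<Rightarrow> real" and c
    proof -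
      have "AE x in lborel. x \<in> ?B \<longrightarrow> norm (g x) \<le> c"
        using g by eventually_elim simp
      then show ?thesis
        using integrableI_bounded_set_indicator[of ?B lborel g c] emeasure_bounded_finite[OF bounded_box, of l u]
        by simp
    qed
    have q_add: "q (v + w) n x = q v n (x + ?h n *\<^sub>R w) + q w n x" for n x
    proof -
      have eq: "x + ?h n *\<^sub>R (v + w) = x + ?h n *\<^sub>R w + ?h n *\<^sub>R v"
        by (simp add: scaleR_right_distrib add_ac)
      then have "f (x + ?h n *\<^sub>R (v + w)) - f x
          = (f (x + ?h n *\<^sub>R w + ?h n *\<^sub>R v) - f (x + ?h n *\<^sub>R w)) + (f (x + ?h n *\<^sub>R w) - f x)"
        unfolding eq by linarith
      then show ?thesis
        unfolding q_def by (simp only: add_divide_distrib)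
    qed
    have split: "(\<integral>x. indicator ?B x * q (v + w) n x \<partial>lborel)
       = (\<integral>x. indicator ?B (x - ?h n *\<^sub>R w) * q v n x \<partial>lborel) + (\<integral>x. indicator ?B x * q w n x \<partial>lborel)" for n
    proof -
      have "(\<integral>x. indicator ?B x * q (v + w) n x \<partial>lborel)
          = (\<integral>x. indicator ?B x * q v n (x + ?h n *\<^sub>R w) + indicator ?B x * q w n x \<partial>lborel)"
        by (simp add: q_add distrib_left)
      also have "\<dots> = (\<integral>x. indicator ?B x * q v n (x + ?h n *\<^sub>R w) \<partial>lborel) + (\<integral>x. indicator ?B x * q w n x \<partial>lborel)"
      proof (rule Bochner_Integration.integral_add)
        show "integrable lborel (\<lambda>x. indicator ?B x * q v n (x + ?h n *\<^sub>R w))"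
          unfolding q_def by (intro iB[where c = "L * norm v"] AE_I2 abs_quotient_le[OF lip]) measurable
        show "integrable lborel (\<lambda>x. indicator ?B x * q w n x)"
          unfolding q_def by (intro iB[where c = "L * norm w"] AE_I2 abs_quotient_le[OF lip]) measurable
      qed
      also have "(\<integral>x. indicator ?B x * q v n (x + ?h n *\<^sub>R w) \<partial>lborel)
          = (\<integral>x. indicator ?B (x - ?h n *\<^sub>R w) * q v n x \<partial>lborel)"
        using integral_lborel_translate[of "\<lambda>x. indicator ?B (x - ?h n *\<^sub>R w) * q v n x" "?h n *\<^sub>R w"] by simp
      finally show ?thesis .
    qed
    have "(\<lambda>n. \<integral>x. indicator ?B x * q (v + w) n x \<partial>lborel) \<longlonglongrightarrow>
       (\<integral>x. indicator ?B x * dir_deriv f v x \<partial>lborel) + (\<integral>x. indicator ?B x * dir_deriv f w x \<partial>lborel)"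
      unfolding split
      using integral_box_quotient_LIMSEQ[OF lip, of l u w v] integral_box_quotient_LIMSEQ[OF lip, of l u 0 w]
      by (intro tendsto_add) (simp_all add: q_def)
    moreover have "(\<lambda>n. \<integral>x. indicator ?B x * q (v + w) n x \<partial>lborel) \<longlonglongrightarrow>
       (\<integral>x. indicator ?B x * dir_deriv f (v + w) x \<partial>lborel)"
      using integral_box_quotient_LIMSEQ[OF lip, of l u 0 "v + w"] by (simp add: q_def)
    ultimately have eq: "(\<integral>x. indicator ?B x * dir_deriv f (v + w) x \<partial>lborel)
      = (\<integral>x. indicator ?B x * dir_deriv f v x \<partial>lborel) + (\<integral>x. indicator ?B x * dir_deriv f w x \<partial>lborel)"
      by (rule LIMSEQ_unique[rotated])
    have i: "integrable lborel (\<lambda>x. indicator ?B x * dir_deriv f v x)" for v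
      by (intro iB[OF _ AE_abs_dir_deriv_le[OF lip]]) measurable
    show "(\<integral>x. indicator ?B x * U x \<partial>lborel) = 0"
      unfolding U_def using eq i by (simp add: right_diff_distrib distrib_left)
  qed
  then show ?thesis by eventually_elim (simp add: U_def)
qed

lemma AE_dir_deriv_scaleR:
  fixes f :: "'a::euclidean_space \<Rightarrow> real"
  assumes lip: "L-lipschitz_on UNIV f"
  shows "AE x in lborel. dir_deriv f (c *\<^sub>R v) x = c * dir_deriv f v x"
proof (cases "c = 0")
  case True
  then show ?thesis by (simp add: dir_deriv_def)
next
  case False
  show ?thesis
    using AE_tendsto_dir_deriv[OF lip, of v]
  proof eventually_elim
    case (elim x)
    have "filterlim (\<lambda>t. t * c) (at 0) (at 0)"
      using False by (auto simp: filterlim_at eventually_at intro!: tendsto_eq_intros exI[of _ 1])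
    from filterlim_compose[OF elim this]
    have "((\<lambda>t. c * ((f (x + (t * c) *\<^sub>R v) - f x) / (t * c))) \<longlongrightarrow> c * dir_deriv f v x) (at 0)"
      by (intro tendsto_mult_left)
    then have "((\<lambda>t. (f (x + t *\<^sub>R (c *\<^sub>R v)) - f x) / t) \<longlongrightarrow> c * dir_deriv f v x) (at 0)"
      using False by simp
    then show ?case by (rule dir_deriv_eqI)
  qed
qed

text \<open>Additivity and homogeneity are applied along the expansion of \<open>v\<close> in the
  basis. The exceptional null set depends on \<open>v\<close>, which is why only countably many
  directions are used afterwards.\<close>

lemma AE_dir_deriv_linear:
  fixes f :: "'a::euclidean_space \<Rightarrow> real"
  assumes lip: "L-lipschitz_on UNIV f"
  shows "AE x in lborel. dir_deriv f v x = v \<bullet> (\<Sum>i\<in>Basis. dir_deriv f i x *\<^sub>R i)"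
proof -
  have "AE x in lborel. dir_deriv f (\<Sum>i\<in>I. (v \<bullet> i) *\<^sub>R i) x = (\<Sum>i\<in>I. (v \<bullet> i) * dir_deriv f i x)" if "finite I" for I
    using that
  proof induction
    case empty
    then show ?case by (simp add: dir_deriv_def)
  next
    case (insert i I)
    show ?case
      using insert.IH AE_dir_deriv_scaleR[OF lip, of "v \<bullet> i" i]
        AE_dir_deriv_add[OF lip, of "(v \<bullet> i) *\<^sub>R i" "\<Sum>i\<in>I. (v \<bullet> i) *\<^sub>R i"]
      by eventually_elim (simp add: insert.hyps)
  qed
  from this[of Basis] show ?thesis
    by (simp add: euclidean_representation inner_sum_right mult.commute)
qed

text \<open>The limits are not assumed uniform in the direction. Compactness of the unit sphere
  yields a finite net from \<open>V\<close>, hence a common radius, and the Lipschitz bound controls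
  the passage from any unit direction to the nearest one in the net.\<close>

lemma has_derivative_of_dense_directions:
  fixes f :: "'a::euclidean_space \<Rightarrow> real"
  assumes lip: "L-lipschitz_on UNIV f"
    and dense: "\<And>X. open X \<Longrightarrow> X \<noteq> {} \<Longrightarrow> \<exists>d\<in>V. d \<in> X"
    and lim: "\<And>v. v \<in> V \<Longrightarrow> ((\<lambda>t. (f (x + t *\<^sub>R v) - f x) / t) \<longlongrightarrow> v \<bullet> D) (at 0)"
  shows "(f has_derivative (\<lambda>h. h \<bullet> D)) (at x)"
  unfolding has_derivative_at_alt
proof (intro conjI allI impI)
  show "bounded_linear (\<lambda>h. h \<bullet> D)" by (rule bounded_linear_inner_left)
  fix e :: real assume "0 < e"
  have "0 \<le> L" using lip by (rule lipschitz_on_nonneg)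
  \<comment> \<open>Three errors add up below: the quotient in the net direction contributes 1,
    replacing the direction inside \<open>f\<close> contributes \<open>L\<close>, and replacing it
    in the linear map contributes \<open>norm D\<close>, each times
    \<open>\<epsilon> * t\<close>.\<close>
  define \<epsilon> where "\<epsilon> = e / (1 + L + norm D)"
  have pos: "1 + L + norm D > 0" using \<open>0 \<le> L\<close> by (simp add: add_pos_nonneg)
  then have "\<epsilon> > 0" and e_eq: "e = \<epsilon> * (1 + L + norm D)"
    using \<open>0 < e\<close> by (simp_all add: \<epsilon>_def)
  have "sphere 0 1 \<subseteq> (\<Union>v\<in>V. ball v \<epsilon>)"
  proof
    fix u :: 'a
    obtain v where "v \<in> V" "v \<in> ball u \<epsilon>"
      using dense[of "ball u \<epsilon>"] \<open>\<epsilon> > 0\<close> by auto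
    then show "u \<in> (\<Union>v\<in>V. ball v \<epsilon>)" by (auto simp: dist_commute)
  qed
  then obtain F where F: "F \<subseteq> V" "finite F" "sphere 0 1 \<subseteq> (\<Union>v\<in>F. ball v \<epsilon>)"
    using compactE_image[OF compact_sphere, of V "\<lambda>v. ball v \<epsilon>"] by (metis open_ball)
  have "\<exists>d>0. \<forall>t. t \<noteq> 0 \<and> \<bar>t\<bar> < d \<longrightarrow> \<bar>(f (x + t *\<^sub>R v) - f x) / t - v \<bullet> D\<bar> < \<epsilon>" if "v \<in> F" for v
    using tendstoD[OF lim, of v \<epsilon>] that F(1) \<open>\<epsilon> > 0\<close> by (auto simp: eventually_at dist_real_def)
  then obtain d where d: "\<And>v. v \<in> F \<Longrightarrow> d v > 0"
    "\<And>v t. \<lbrakk>v \<in> F; t \<noteq> 0; \<bar>t\<bar> < d v\<rbrakk> \<Longrightarrow> \<bar>(f (x + t *\<^sub>R v) - f x) / t - v \<bullet> D\<bar> < \<epsilon>"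
    by metis
  define d0 where "d0 = Min (insert 1 (d ` F))"
  have "d0 > 0" "\<And>v. v \<in> F \<Longrightarrow> d0 \<le> d v"
    using F(2) d(1) by (auto simp: d0_def)
  show "\<exists>d>0. \<forall>y. norm (y - x) < d \<longrightarrow> norm (f y - f x - (y - x) \<bullet> D) \<le> e * norm (y - x)"
  proof (intro exI[of _ d0] conjI allI impI \<open>d0 > 0\<close>)
    fix y assume y: "norm (y - x) < d0"
    show "norm (f y - f x - (y - x) \<bullet> D) \<le> e * norm (y - x)"
    proof (cases "y = x")
      case False
      define t where "t = norm (y - x)"
      define u where "u = (y - x) /\<^sub>R t"
      have t: "t > 0" and u: "norm u = 1" and yx: "y = x + t *\<^sub>R u"
        using False by (auto simp: t_def u_def)
      obtain v where v: "v \<in> F" "norm (u - v) < \<epsilon>"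
        using F(3) u by (force simp: dist_norm norm_minus_commute)
      have "\<bar>(f (x + t *\<^sub>R v) - f x) / t - v \<bullet> D\<bar> < \<epsilon>"
        using d(2)[OF v(1), of t] t y \<open>v \<in> F \<Longrightarrow> d0 \<le> d v\<close> v(1) by (auto simp: t_def)
      moreover have "(f (x + t *\<^sub>R v) - f x) / t - v \<bullet> D = (f (x + t *\<^sub>R v) - f x - t * (v \<bullet> D)) / t"
        using t by (simp add: field_simps)
      ultimately have 1: "\<bar>f (x + t *\<^sub>R v) - f x - t * (v \<bullet> D)\<bar> \<le> \<epsilon> * t"
        using t by (simp add: abs_divide field_simps)
      have "\<bar>f (x + t *\<^sub>R u) - f (x + t *\<^sub>R v)\<bar> \<le> L * norm (t *\<^sub>R (u - v))"
        using lipschitz_onD[OF lip, of "x + t *\<^sub>R u" "x + t *\<^sub>R v"] by (simp add: dist_norm scaleR_diff_right)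
      also have "\<dots> \<le> L * (t * \<epsilon>)"
        using v(2) t \<open>0 \<le> L\<close> by (intro mult_left_mono) auto
      finally have 2: "\<bar>f (x + t *\<^sub>R u) - f (x + t *\<^sub>R v)\<bar> \<le> L * (t * \<epsilon>)" .
      have "\<bar>(u - v) \<bullet> D\<bar> \<le> norm (u - v) * norm D"
        by (rule Cauchy_Schwarz_ineq2)
      also have "\<dots> \<le> \<epsilon> * norm D"
        using v(2) by (intro mult_right_mono) auto
      finally have "t * \<bar>(u - v) \<bullet> D\<bar> \<le> t * (\<epsilon> * norm D)"
        using t by (intro mult_left_mono) auto
      then have 3: "\<bar>t * (v \<bullet> D) - t * (u \<bullet> D)\<bar> \<le> t * (\<epsilon> * norm D)"
        using t by (simp add: inner_diff_left right_diff_distrib[symmetric] abs_mult abs_minus_commute)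
      have "\<bar>f y - f x - t * (u \<bullet> D)\<bar> \<le> \<epsilon> * t + L * (t * \<epsilon>) + t * (\<epsilon> * norm D)"
        using 1 2 3 unfolding yx by linarith
      also have "\<dots> = e * t"
        by (simp add: e_eq algebra_simps)
      finally show ?thesis
        using t by (simp add: yx u)
    qed simp
  qed
qed

lemma AE_has_derivative_of_lipschitz:
  fixes f :: "'a::euclidean_space \<Rightarrow> real"
  assumes lip: "L-lipschitz_on UNIV f"
  shows "AE x in lborel. (f has_derivative (\<lambda>h. h \<bullet> (\<Sum>i\<in>Basis. dir_deriv f i x *\<^sub>R i))) (at x)"
proof -
  obtain V :: "'a set" where V: "countable V" "\<And>X. open X \<Longrightarrow> X \<noteq> {} \<Longrightarrow> \<exists>d\<in>V. d \<in> X"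
    using countable_dense_setE by blast
  have "AE x in lborel. \<forall>v\<in>V. ((\<lambda>t. (f (x + t *\<^sub>R v) - f x) / t) \<longlongrightarrow> dir_deriv f v x) (at 0)
      \<and> dir_deriv f v x = v \<bullet> (\<Sum>i\<in>Basis. dir_deriv f i x *\<^sub>R i)"
    using V(1) AE_tendsto_dir_deriv[OF lip] AE_dir_deriv_linear[OF lip]
    by (intro AE_ball_countable') auto
  then show ?thesis
    by eventually_elim (rule has_derivative_of_dense_directions[OF lip V(2)], auto)
qed

text \<open>Negligibility can be checked locally. Composing \<open>f\<close> with the projection
  onto a small closed ball gives a globally Lipschitz function that agrees with \<open>f\<close> on
  the open ball and so has the same derivatives there.\<close>

lemma rademacher:
  fixes f :: "'a::euclidean_space \<Rightarrow> real"
  assumes "open \<Omega>" and lip: "locally_lipschitz_on \<Omega> f"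
  shows "negligible {x \<in> \<Omega>. \<not> (\<exists>D. GDERIV f x :> D)}"
proof (rule locally_negligible_alt[THEN iffD2], rule ballI)
  let ?S = "{x \<in> \<Omega>. \<not> (\<exists>D. GDERIV f x :> D)}"
  fix a assume a: "a \<in> ?S"
  from a have "a \<in> \<Omega>" by simp
  from lip[unfolded locally_lipschitz_on_def, THEN bspec, OF this]
  obtain r L where r: "r > 0" and L: "L-lipschitz_on (ball a r \<inter> \<Omega>) f"
    by (elim exE conjE) (rule that)
  obtain s where s: "s > 0" "ball a s \<subseteq> \<Omega>"
    using openE[OF \<open>open \<Omega>\<close> \<open>a \<in> \<Omega>\<close>] .
  define \<rho> where "\<rho> = min r s / 2"
  have "\<rho> > 0" "cball a \<rho> \<subseteq> ball a r \<inter> \<Omega>"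
    using r s by (auto simp: \<rho>_def)
  then have L': "L-lipschitz_on (cball a \<rho>) f"
    using L lipschitz_on_subset by blast
  define g where "g = (\<lambda>x. f (closest_point (cball a \<rho>) x))"
  have "L-lipschitz_on UNIV g"
  proof (rule lipschitz_onI)
    fix x y
    have "dist (g x) (g y) \<le> L * dist (closest_point (cball a \<rho>) x) (closest_point (cball a \<rho>) y)"
      unfolding g_def using \<open>\<rho> > 0\<close> by (intro lipschitz_onD[OF L'] closest_point_in_set) auto
    also have "\<dots> \<le> L * dist x y"
      using \<open>\<rho> > 0\<close> lipschitz_on_nonneg[OF L] by (intro mult_left_mono closest_point_lipschitz) auto
    finally show "dist (g x) (g y) \<le> L * dist x y" .
  qed (rule lipschitz_on_nonneg[OF L])
  from AE_has_derivative_of_lipschitz[OF this]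
  have "AE x in lebesgue. \<exists>D. GDERIV g x :> D"
    by (intro AE_completion) (auto simp: gderiv_def elim!: eventually_mono)
  then obtain N where N: "{x \<in> space lebesgue. \<not> (\<exists>D. GDERIV g x :> D)} \<subseteq> N" "emeasure lebesgue N = 0" "N \<in> sets lebesgue"
    by (rule AE_E)
  then have "negligible N"
    by (simp add: negligible_iff_null_sets null_setsI)
  moreover have "?S \<inter> ball a \<rho> \<subseteq> N"
  proof
    fix x assume x: "x \<in> ?S \<inter> ball a \<rho>"
    have "\<not> (GDERIV g x :> D)" for D
    proof
      assume "GDERIV g x :> D"
      then have "(f has_derivative (\<lambda>h. h \<bullet> D)) (at x)"
        unfolding gderiv_def
        by (rule has_derivative_transform_within_open[of _ _ _ _ "ball a \<rho>"])
           (use x in \<open>auto simp: g_def closest_point_self\<close>)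
      with x show False by (auto simp: gderiv_def)
    qed
    with N(1) show "x \<in> N" by auto
  qed
  ultimately have "negligible (?S \<inter> ball a \<rho>)"
    using negligible_subset by blast
  then show "\<exists>U. openin (top_of_set ?S) U \<and> a \<in> U \<and> negligible U"
    using a \<open>\<rho> > 0\<close> by (intro exI[of _ "?S \<inter> ball a \<rho>"]) (auto intro: openin_open_Int)
qed

subsection \<open>Absolutely continuous curves\<close>

text \<open>Carries the condition from families indexed by initial segments of the naturals to
  arbitrary finite index sets, such as the tagged intervals of a division. The total length is small
  because the disjoint intervals lie in \<open>U\<close>.\<close>

lemma absolutely_continuous_curve_finite_sum:
  fixes \<gamma> :: "real \<Rightarrow> 'a::euclidean_space"
  assumes ac: "\<forall>(m::nat) a b. (\<forall>i<m. 0 \<le> a i \<and> a i \<le> b i \<and> b i \<le> 1) \<and>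
        disjoint_family_on (\<lambda>i. {a i<..<b i}) {..<m} \<and> (\<Sum>i<m. b i - a i) < \<eta>
      \<longrightarrow> (\<Sum>i<m. dist (\<gamma> (a i)) (\<gamma> (b i))) < e"
    and I: "finite I" "\<And>i. i \<in> I \<Longrightarrow> 0 \<le> l i \<and> l i \<le> u i \<and> u i \<le> 1"
    and disj: "disjoint_family_on (\<lambda>i. {l i<..<u i}) I"
    and U: "\<And>i. i \<in> I \<Longrightarrow> {l i<..<u i} \<subseteq> U" "U \<in> sets lebesgue" "emeasure lebesgue U < ennreal \<eta>"
  shows "(\<Sum>i\<in>I. dist (\<gamma> (l i)) (\<gamma> (u i))) < e"
proof -
  obtain h where h: "bij_betw h {..<card I} I"
    using ex_bij_betw_nat_finite[OF I(1), unfolded atLeast0LessThan] by (elim exE) (rule that)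
  have hI: "h i \<in> I" if "i < card I" for i
    using bij_betwE[OF h] that by blast
  have "ennreal (\<Sum>i\<in>I. u i - l i) = (\<Sum>i\<in>I. ennreal (u i - l i))"
    using I(2) by (intro sum_ennreal[symmetric]) auto
  also have "\<dots> = (\<Sum>i\<in>I. emeasure lebesgue {l i<..<u i})"
    using I(2) by (intro sum.cong refl) simp
  also have "\<dots> = emeasure lebesgue (\<Union>i\<in>I. {l i<..<u i})"
    using disj I(1) by (intro sum_emeasure) auto
  also have "\<dots> \<le> emeasure lebesgue U"
    using U(1,2) by (intro emeasure_mono) auto
  also have "\<dots> < ennreal \<eta>" by (rule U(3))
  finally have "(\<Sum>i\<in>I. u i - l i) < \<eta>"
    using I(2) by (subst (asm) ennreal_less_iff) (auto intro!: sum_nonneg)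
  then have lt: "(\<Sum>i<card I. u (h i) - l (h i)) < \<eta>"
    by (simp add: sum.reindex_bij_betw[OF h, of "\<lambda>i. u i - l i"])
  have "disjoint_family_on (\<lambda>i. {l (h i)<..<u (h i)}) {..<card I}"
    unfolding disjoint_family_on_def
  proof (intro ballI impI)
    fix i j assume ij: "i \<in> {..<card I}" "j \<in> {..<card I}" "i \<noteq> j"
    then have "h i \<noteq> h j"
      using h by (auto simp: bij_betw_def inj_on_def)
    then show "{l (h i)<..<u (h i)} \<inter> {l (h j)<..<u (h j)} = {}"
      using disj hI ij unfolding disjoint_family_on_def by blast
  qed
  then have "(\<Sum>i<card I. dist (\<gamma> (l (h i))) (\<gamma> (u (h i)))) < e"
    using lt hI I(2) by (intro ac[rule_format] conjI) auto
  then show ?thesis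
    by (simp add: sum.reindex_bij_betw[OF h, of "\<lambda>i. dist (\<gamma> (l i)) (\<gamma> (u i))"])
qed

text \<open>The gauge at a point of \<open>N\<close> is an open superset of \<open>N\<close> of small measure, so that absolute continuity makes
  the intervals tagged in \<open>N\<close> negligible.\<close>
lemma fundamental_theorem_of_calculus_absolutely_continuous:
  fixes \<gamma> :: "real \<Rightarrow> 'a::euclidean_space"
  assumes ac: "absolutely_continuous_curve \<gamma>" and ab: "0 \<le> a" "a \<le> b" "b \<le> 1"
    and N: "negligible N"
    and der: "\<And>t. t \<in> {a..b} - N \<Longrightarrow> (\<gamma> has_vector_derivative \<gamma>' t) (at t within {0..1})"
    and zero: "\<And>t. t \<in> N \<Longrightarrow> \<gamma>' t = 0"
  shows "(\<gamma>' has_integral (\<gamma> b - \<gamma> a)) {a..b}"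
  unfolding has_integral_real
proof (intro allI impI)
  fix e :: real assume "0 < e"
  \<comment> \<open>Half of \<open>e\<close> is reserved for the tags in \<open>N\<close>; the
    \<open>+ 1\<close> covers \<open>a = b\<close>.\<close>
  define e' where "e' = e / (2 * (b - a + 1))"
  have "e' > 0" using \<open>0 < e\<close> ab by (simp add: e'_def)
  have "e / 2 > 0" using \<open>0 < e\<close> by simp
  from ac[unfolded absolutely_continuous_curve_def, THEN spec[of _ "e / 2"], THEN mp, OF this]
  obtain \<eta> where \<eta>: "\<eta> > 0" "\<forall>(m::nat) a b. (\<forall>i<m. 0 \<le> a i \<and> a i \<le> b i \<and> b i \<le> 1) \<and>
        disjoint_family_on (\<lambda>i. {a i<..<b i}) {..<m} \<and> (\<Sum>i<m. b i - a i) < \<eta>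
      \<longrightarrow> (\<Sum>i<m. dist (\<gamma> (a i)) (\<gamma> (b i))) < e / 2"
    by (elim exE conjE) (rule that)
  obtain U where U: "open U" "N \<subseteq> U" "emeasure lebesgue (U - N) < ennreal \<eta>"
    using sets_lebesgue_outer_open[OF negligible_imp_sets[OF N] \<eta>(1)] by metis
  have mU: "emeasure lebesgue U < ennreal \<eta>"
    using U N by (simp add: emeasure_Diff_null_set negligible_iff_null_sets)
  have "\<forall>x. \<exists>d>0. x \<in> {a..b} - N \<longrightarrow>
         (\<forall>y\<in>{0..1}. norm (y-x) < d \<longrightarrow> norm (\<gamma> y - \<gamma> x - (y-x) *\<^sub>R \<gamma>' x) \<le> e' * norm (y-x))"
    using der[unfolded has_vector_derivative_def has_derivative_within_alt] \<open>e' > 0\<close>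
    by (metis (no_types, lifting) zero_less_one)
  then obtain d where d: "\<And>x. 0 < d x"
     "\<And>x y. \<lbrakk>x \<in> {a..b} - N; y \<in> {0..1}; norm (y-x) < d x\<rbrakk>
           \<Longrightarrow> norm (\<gamma> y - \<gamma> x - (y-x) *\<^sub>R \<gamma>' x) \<le> e' * norm (y-x)"
    by metis
  define g where "g = (\<lambda>x. if x \<in> N then U else ball x (d x))"
  show "\<exists>g. gauge g \<and> (\<forall>p. p tagged_division_of {a..b} \<and> g fine p \<longrightarrow>
      norm ((\<Sum>(x, K)\<in>p. measure lborel K *\<^sub>R \<gamma>' x) - (\<gamma> b - \<gamma> a)) < e)"
  proof (intro exI[of _ g] conjI allI impI; (elim conjE)?)
    show "gauge g"
      unfolding gauge_def g_def using U d(1) by auto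
    fix p assume p: "p tagged_division_of {a..b}" and fine: "g fine p"
    have fin: "finite p" using p by blast
    have K: "Inf K \<le> Sup K \<and> K = {Inf K..Sup K} \<and> a \<le> Inf K \<and> Sup K \<le> b \<and> x \<in> K \<and> K \<subseteq> g x"
      if xK: "(x, K) \<in> p" for x K
    proof -
      obtain u v where uv: "K = cbox u v" "x \<in> K" "K \<subseteq> {a..b}"
        using tagged_division_ofD(2,3)[OF p xK] tagged_division_ofD(4)[OF p xK] by blast
      then show ?thesis using fineD[OF fine xK] by auto
    qed
    define err where "err = (\<lambda>(x, K). measure lborel K *\<^sub>R \<gamma>' x - (\<gamma> (Sup K) - \<gamma> (Inf K)))"
    define p1 p2 where "p1 = {i \<in> p. fst i \<notin> N}" and "p2 = {i \<in> p. fst i \<in> N}"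
    have p12: "p = p1 \<union> p2" "p1 \<inter> p2 = {}" "finite p1" "finite p2"
      using fin by (auto simp: p1_def p2_def)
    \<comment> \<open>Away from \<open>N\<close>, differentiability at the tag is used on both sides
      of it, towards each endpoint; the errors are proportional to the lengths, which add up to
      \<open>b - a\<close>.\<close>
    have "norm (sum err p1) \<le> (\<Sum>(x, K)\<in>p1. e' * (Sup K - Inf K))"
    proof (rule sum_norm_le, clarify)
      fix x K assume "(x, K) \<in> p1"
      then have xK: "(x, K) \<in> p" "x \<notin> N" by (auto simp: p1_def)
      define u v where "u = Inf K" and "v = Sup K"
      have Kuv: "K = {u..v}"
        using K[OF xK(1)] by (simp add: u_def v_def)
      have uv: "u \<le> v" "a \<le> u" "v \<le> b" "x \<in> {u..v}" "{u..v} \<subseteq> ball x (d x)"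
        using K[OF xK(1)] xK(2) unfolding u_def[symmetric] v_def[symmetric] by (auto simp: g_def)
      have eq: "Inf K = u" "Sup K = v" "measure lborel K = v - u"
        using uv(1) by (auto simp: u_def[symmetric] v_def[symmetric] Kuv)
      have x: "x \<in> {a..b} - N" using uv xK by auto
      have "u \<in> ball x (d x)" "v \<in> ball x (d x)"
        using uv(1,5) by (meson atLeastAtMost_iff order_refl subsetD)+
      then have near: "norm (u - x) < d x" "norm (v - x) < d x"
        by (auto simp: dist_norm norm_minus_commute)
      have u: "norm (\<gamma> u - \<gamma> x - (u-x) *\<^sub>R \<gamma>' x) \<le> e' * (x - u)"
        using d(2)[OF x _ near(1)] uv ab by auto
      have v: "norm (\<gamma> v - \<gamma> x - (v-x) *\<^sub>R \<gamma>' x) \<le> e' * (v - x)"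
        using d(2)[OF x _ near(2)] uv ab by auto
      have "norm ((v - u) *\<^sub>R \<gamma>' x - (\<gamma> v - \<gamma> u))
          = norm ((\<gamma> u - \<gamma> x - (u-x) *\<^sub>R \<gamma>' x) - (\<gamma> v - \<gamma> x - (v-x) *\<^sub>R \<gamma>' x))"
        by (simp add: algebra_simps)
      also have "\<dots> \<le> e' * (x - u) + e' * (v - x)"
        using u v norm_triangle_ineq4 by (smt (verit))
      also have "\<dots> = e' * (v - u)" by (simp add: algebra_simps)
      finally show "norm (err (x, K)) \<le> e' * (Sup K - Inf K)"
        by (simp add: err_def eq)
    qed
    also have "\<dots> \<le> (\<Sum>(x, K)\<in>p. e' * (Sup K - Inf K))"
      using p12 \<open>e' > 0\<close> fin K by (intro sum_mono2) (auto simp: p1_def split: prod.splits)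
    also have "\<dots> = e' * (b - a)"
      using additive_tagged_division_1[of a b p "\<lambda>x. x"] ab p
      by (simp add: sum_distrib_left[symmetric] case_prod_unfold)
    also have "\<dots> < e / 2"
      using \<open>0 < e\<close> ab by (simp add: e'_def field_simps)
    finally have 1: "norm (sum err p1) < e / 2" .
    \<comment> \<open>At tags in \<open>N\<close> the integrand is zero, so the error consists of
      increments of \<open>\<gamma>\<close> over non-overlapping intervals inside
      \<open>U\<close>.\<close>
    have "norm (sum err p2) \<le> (\<Sum>i\<in>p2. dist (\<gamma> (Inf (snd i))) (\<gamma> (Sup (snd i))))"
      by (intro sum_norm_le) (auto simp: err_def p2_def zero dist_norm norm_minus_commute)
    also have "\<dots> < e / 2"
    proof (rule absolutely_continuous_curve_finite_sum[OF \<eta>(2) p12(4), where U = U])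
      show "0 \<le> Inf (snd i) \<and> Inf (snd i) \<le> Sup (snd i) \<and> Sup (snd i) \<le> 1" if "i \<in> p2" for i
        using K[of "fst i" "snd i"] that ab by (auto simp: p2_def)
      show "disjoint_family_on (\<lambda>i. {Inf (snd i)<..<Sup (snd i)}) p2"
        unfolding disjoint_family_on_def
      proof (intro ballI impI)
        fix i j assume ij: "i \<in> p2" "j \<in> p2" "i \<noteq> j"
        then have *: "(fst i, snd i) \<in> p" "(fst j, snd j) \<in> p" by (auto simp: p2_def)
        have "interior (snd i) \<inter> interior (snd j) = {}"
          using tagged_division_ofD(5)[OF p *] ij(3) by (simp add: prod_eq_iff)
        moreover have "interior (snd i) = {Inf (snd i)<..<Sup (snd i)}"
          "interior (snd j) = {Inf (snd j)<..<Sup (snd j)}"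
          using K[OF *(1)] K[OF *(2)] by (metis interior_atLeastAtMost_real)+
        ultimately show "{Inf (snd i)<..<Sup (snd i)} \<inter> {Inf (snd j)<..<Sup (snd j)} = {}"
          by simp
      qed
      show "{Inf (snd i)<..<Sup (snd i)} \<subseteq> U" if "i \<in> p2" for i
      proof -
        have "snd i = {Inf (snd i)..Sup (snd i)}" "snd i \<subseteq> U"
          using K[of "fst i" "snd i"] that by (auto simp: p2_def g_def)
        then show ?thesis by (metis greaterThanLessThan_subseteq_atLeastAtMost_iff order_refl subset_trans)
      qed
    qed (use U mU in auto)
    finally have 2: "norm (sum err p2) < e / 2" .
    have "(\<Sum>(x, K)\<in>p. measure lborel K *\<^sub>R \<gamma>' x) - (\<gamma> b - \<gamma> a) = sum err p"
      using additive_tagged_division_1[of a b p \<gamma>] ab p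
      by (simp add: err_def sum_subtractf case_prod_unfold)
    also have "\<dots> = sum err p1 + sum err p2"
      using p12 by (simp add: sum.union_disjoint)
    finally show "norm ((\<Sum>(x, K)\<in>p. measure lborel K *\<^sub>R \<gamma>' x) - (\<gamma> b - \<gamma> a)) < e"
      using 1 2 norm_triangle_ineq[of "sum err p1" "sum err p2"] by simp
  qed
qed

lemma negligible_of_AE_lebesgue_on:
  assumes "AE x\<in>S in lebesgue. P x"
  shows "negligible {x \<in> S. \<not> P x}"
proof -
  obtain N where N: "{x \<in> space lebesgue. \<not> (x \<in> S \<longrightarrow> P x)} \<subseteq> N" "emeasure lebesgue N = 0" "N \<in> sets lebesgue"
    using assms by (rule AE_E)
  then have "negligible N"
    by (simp add: negligible_iff_null_sets null_setsI)
  then show ?thesis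
    by (rule negligible_subset) (use N(1) in auto)
qed

text \<open>Absolute continuity makes each increment the integral of the velocity. Setting the
  velocity to zero on the exceptional set makes the bound \<open>K\<close> hold everywhere, so the
  integral is at most \<open>K\<close> times the length.\<close>

lemma lipschitz_of_absolutely_continuous_curve:
  fixes \<gamma> :: "real \<Rightarrow> 'a::euclidean_space"
  assumes ac: "absolutely_continuous_curve \<gamma>" and "0 \<le> K"
    and der: "AE s\<in>{0..1} in lebesgue.
        \<exists>v. (\<gamma> has_vector_derivative v) (at s within {0..1}) \<and> norm v \<le> K"
  shows "K-lipschitz_on {0..1} \<gamma>"
proof -
  define N where "N = {s \<in> {0..1}. \<not> (\<exists>v. (\<gamma> has_vector_derivative v) (at s within {0..1}) \<and> norm v \<le> K)}"
  have N: "negligible N"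
    unfolding N_def using der by (rule negligible_of_AE_lebesgue_on)
  have "\<forall>s. \<exists>v. if s \<in> {0..1} - N then (\<gamma> has_vector_derivative v) (at s within {0..1}) \<and> norm v \<le> K else v = 0"
    by (auto simp: N_def)
  then obtain \<gamma>' where \<gamma>': "\<And>s. if s \<in> {0..1} - N then (\<gamma> has_vector_derivative \<gamma>' s) (at s within {0..1}) \<and> norm (\<gamma>' s) \<le> K else \<gamma>' s = 0"
    by metis
  have *: "dist (\<gamma> a) (\<gamma> b) \<le> K * dist a b" if "a \<in> {0..1}" "b \<in> {0..1}" "a \<le> b" for a b
  proof -
    have "(\<gamma>' has_integral (\<gamma> b - \<gamma> a)) (cbox a b)"
      unfolding box_real
    proof (rule fundamental_theorem_of_calculus_absolutely_continuous[OF ac _ _ _ N])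
      fix t assume "t \<in> {a..b} - N"
      then have "t \<in> {0..1} - N" using that by auto
      then show "(\<gamma> has_vector_derivative \<gamma>' t) (at t within {0..1})"
        using \<gamma>'[of t] by (simp del: Diff_iff)
    qed (use that \<gamma>' in \<open>auto split: if_splits\<close>)
    then have "norm (\<gamma> b - \<gamma> a) \<le> K * measure lborel (cbox a b)"
    proof (rule has_integral_bound[OF \<open>0 \<le> K\<close>])
      show "norm (\<gamma>' x) \<le> K" for x
        using \<gamma>'[of x] \<open>0 \<le> K\<close> by (auto split: if_splits)
    qed
    then show ?thesis
      using that by (simp add: dist_norm norm_minus_commute)
  qed
  show ?thesis
    by (intro lipschitz_onI \<open>0 \<le> K\<close>) (metis * dist_commute linear)
qed

text \<open>Makes the fundamental theorem available for a Lipschitz function of the curve parameter,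
  such as \<open>f\<close> along a tilted curve.\<close>

lemma absolutely_continuous_curve_of_lipschitz:
  fixes \<gamma> :: "real \<Rightarrow> 'a::euclidean_space"
  assumes lip: "L-lipschitz_on {0..1} \<gamma>"
  shows "absolutely_continuous_curve \<gamma>"
  unfolding absolutely_continuous_curve_def
proof (intro allI impI, goal_cases)
  case (1 e)
  have "0 \<le> L" using lip by (rule lipschitz_on_nonneg)
  show ?case
  proof (intro exI[of _ "e / (L + 1)"] conjI allI impI; (elim conjE)?)
    show "0 < e / (L + 1)" using 1 \<open>0 \<le> L\<close> by simp
    fix m :: nat and a b :: "nat \<Rightarrow> real"
    assume ab: "\<forall>i<m. 0 \<le> a i \<and> a i \<le> b i \<and> b i \<le> 1" and s: "(\<Sum>i<m. b i - a i) < e / (L + 1)"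
    have "(\<Sum>i<m. dist (\<gamma> (a i)) (\<gamma> (b i))) \<le> (\<Sum>i<m. L * (b i - a i))"
    proof (rule sum_mono)
      fix i assume "i \<in> {..<m}"
      then have "0 \<le> a i" "a i \<le> b i" "b i \<le> 1" using ab by auto
      then show "dist (\<gamma> (a i)) (\<gamma> (b i)) \<le> L * (b i - a i)"
        using lipschitz_onD[OF lip, of "a i" "b i"] by (auto simp: dist_real_def)
    qed
    also have "\<dots> \<le> (L + 1) * (\<Sum>i<m. b i - a i)"
    proof -
      have "0 \<le> (\<Sum>i<m. b i - a i)" using ab by (intro sum_nonneg) auto
      then show ?thesis by (simp add: sum_distrib_left[symmetric] distrib_right)
    qed
    also have "\<dots> < e"
      using s \<open>0 \<le> L\<close> by (simp add: field_simps)
    finally show "(\<Sum>i<m. dist (\<gamma> (a i)) (\<gamma> (b i))) < e" .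
  qed
qed

text \<open>The derivative is bounded by \<open>L\<close>, hence absolutely integrable. The gauge
  integral giving the increment is then a Lebesgue integral and can be compared with that of
  \<open>G\<close>, even if the latter is infinite.\<close>

lemma lipschitz_increment_le_nn_integral:
  fixes h :: "real \<Rightarrow> real" and G :: "real \<Rightarrow> ennreal"
  assumes lip: "L-lipschitz_on {0..1} h"
    and der: "AE s\<in>{0..1} in lebesgue.
        \<exists>v. (h has_vector_derivative v) (at s within {0..1}) \<and> ennreal \<bar>v\<bar> \<le> G s"
  shows "ennreal \<bar>h 1 - h 0\<bar> \<le> (\<integral>\<^sup>+s\<in>{0..1}. G s \<partial>lebesgue)"
proof -
  define N where "N = {s \<in> {0..1}. \<not> (\<exists>v. (h has_vector_derivative v) (at s within {0..1}) \<and> ennreal \<bar>v\<bar> \<le> G s)}"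
  have N: "negligible N"
    unfolding N_def using der by (rule negligible_of_AE_lebesgue_on)
  have "\<forall>s. \<exists>v. if s \<in> {0..1} - N then (h has_vector_derivative v) (at s within {0..1}) \<and> ennreal \<bar>v\<bar> \<le> G s else v = 0"
    by (auto simp: N_def)
  then obtain h' where h': "\<And>s. if s \<in> {0..1} - N then (h has_vector_derivative h' s) (at s within {0..1}) \<and> ennreal \<bar>h' s\<bar> \<le> G s else h' s = 0"
    by metis
  have "0 \<le> L" using lip by (rule lipschitz_on_nonneg)
  have bound: "norm (h' s) \<le> L" for s
  proof (cases "s \<in> {0..1} - N")
    case True
    then have "(h has_vector_derivative h' s) (at s within {0..1})"
      using h'[of s] by (simp del: Diff_iff)
    then have lim: "((\<lambda>y. (h y - h s) / (y - s)) \<longlongrightarrow> h' s) (at s within {0..1})"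
      by (simp add: has_real_derivative_iff_has_vector_derivative[symmetric] has_field_derivative_iff)
    have "eventually (\<lambda>y. norm ((h y - h s) / (y - s)) \<le> L) (at s within {0..1})"
      unfolding eventually_at
    proof (intro exI[of _ 1] conjI ballI impI, simp, elim conjE)
      fix y assume "y \<in> {0..1}" "y \<noteq> s" "dist y s < 1"
      then show "norm ((h y - h s) / (y - s)) \<le> L"
        using lipschitz_onD[OF lip, of y s] True by (simp add: dist_real_def field_simps)
    qed
    moreover have "at s within {0..1} \<noteq> bot"
      using True by (auto simp: trivial_limit_within islimpt_Icc)
    ultimately show ?thesis
      using Lim_norm_ubound[OF _ lim] by blast
  next
    case False
    then show ?thesis using h'[of s] \<open>0 \<le> L\<close> by simp
  qed
  have I: "(h' has_integral (h 1 - h 0)) {0..1}"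
  proof (rule fundamental_theorem_of_calculus_absolutely_continuous[OF _ _ _ _ N])
    show "absolutely_continuous_curve h"
      using lip by (rule absolutely_continuous_curve_of_lipschitz)
    show "(h has_vector_derivative h' t) (at t within {0..1})" if "t \<in> {0..1} - N" for t
      using h'[of t] that by (simp del: Diff_iff)
  qed (use h' in \<open>auto split: if_splits\<close>)
  have "h' absolutely_integrable_on {0..1}"
    using I bound
    by (intro absolutely_integrable_integrable_bound[where g = "\<lambda>_. L"])
       (auto intro: has_integral_integrable simp: integrable_const_ivl)
  then have int: "integrable lebesgue (\<lambda>s. indicator {0..1} s *\<^sub>R h' s)" 
    by (simp add: set_integrable_def)
  have "h 1 - h 0 = (\<integral>s. indicator {0..1} s *\<^sub>R h' s \<partial>lebesgue)"
    using set_lebesgue_integral_eq_integral(2)[OF \<open>h' absolutely_integrable_on {0..1}\<close>] I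
    by (simp add: set_lebesgue_integral_def integral_unique)
  then have "ennreal \<bar>h 1 - h 0\<bar> \<le> (\<integral>\<^sup>+s. norm (indicator {0..1} s *\<^sub>R h' s) \<partial>lebesgue)"
    using integral_norm_bound_ennreal[OF int] by simp
  also have "\<dots> \<le> (\<integral>\<^sup>+s\<in>{0..1}. G s \<partial>lebesgue)"
  proof (rule nn_integral_mono)
    fix s
    show "ennreal (norm (indicator {0..1} s *\<^sub>R h' s)) \<le> G s * indicator {0..1} s"
      using h'[of s] by (cases "s \<in> {0..1}"; cases "s \<in> N") auto
  qed
  finally show ?thesis .
qed

subsection \<open>Gradients along tilted curves\<close>

text \<open>A segment from \<open>p\<close> to a point outside \<open>\<Omega>\<close> meets the
  frontier, no farther from \<open>p\<close> than its endpoint.\<close>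

lemma mem_of_norm_less_boundary_dist:
  fixes \<Omega> :: "'a::euclidean_space set"
  assumes "p \<in> \<Omega>" "norm (q - p) < boundary_dist \<Omega> p"
  shows "q \<in> \<Omega>"
proof (rule ccontr)
  assume "q \<notin> \<Omega>"
  then have "closed_segment p q \<inter> frontier \<Omega> \<noteq> {}"
    using assms(1) by (intro connected_Int_frontier connected_segment) auto
  then obtain c where c: "c \<in> closed_segment p q" "c \<in> frontier \<Omega>" by blast
  have "boundary_dist \<Omega> p \<le> dist p c"
    unfolding boundary_dist_def using c(2) by (rule infdist_le)
  also have "\<dots> \<le> norm (q - p)"
    using segment_bound1[OF c(1)] by (simp add: dist_norm norm_minus_commute)
  finally show False using assms(2) by simp
qed

lemma boundary_dist_le: "boundary_dist \<Omega> p \<le> boundary_dist \<Omega> q + dist p q"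
  unfolding boundary_dist_def by (rule infdist_triangle)

lemma borel_measurable_boundary_dist [measurable]: "boundary_dist \<Omega> \<in> borel_measurable borel"
  unfolding boundary_dist_def [abs_def]
  by (intro borel_measurable_continuous_onI continuous_intros)

lemma continuous_on_locally_lipschitz:
  assumes "open \<Omega>" "locally_lipschitz_on \<Omega> f"
  shows "continuous_on \<Omega> f"
proof (rule continuous_at_imp_continuous_on, rule ballI)
  fix x assume x: "x \<in> \<Omega>"
  from assms(2)[unfolded locally_lipschitz_on_def, THEN bspec, OF x]
  obtain r L where r: "r > 0" and L: "L-lipschitz_on (ball x r \<inter> \<Omega>) f"
    by (elim exE conjE) (rule that)
  have "open (ball x r \<inter> \<Omega>)" "x \<in> ball x r \<inter> \<Omega>"
    using assms(1) r x by auto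
  then show "isCont f x"
    using lipschitz_on_continuous_on[OF L] by (simp add: continuous_on_eq_continuous_at)
qed

lemma gradient_eqI:
  assumes "GDERIV f x :> D"
  shows "gradient f x = D"
  unfolding gradient_def
proof (rule the_equality)
  show "GDERIV f x :> D" by (rule assms)
next
  fix D' assume "GDERIV f x :> D'"
  then have "(\<lambda>h. h \<bullet> D') = (\<lambda>h. h \<bullet> D)"
    using assms unfolding gderiv_def by (rule has_derivative_unique)
  then have "(D' - D) \<bullet> D' = (D' - D) \<bullet> D" by (rule fun_cong)
  then have "(D' - D) \<bullet> (D' - D) = 0" by (simp add: inner_diff_right[of "D' - D" D' D])
  then show "D' = D" by simp
qed

lemma dir_deriv_of_GDERIV:
  assumes "GDERIV f x :> D"
  shows "dir_deriv f v x = v \<bullet> D"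
proof (rule dir_deriv_eqI)
  have "(f has_derivative (\<lambda>h. h \<bullet> D)) (at (x + 0 *\<^sub>R v))"
    using assms by (simp add: gderiv_def)
  moreover have "((\<lambda>t. x + t *\<^sub>R v) has_derivative (\<lambda>t. t *\<^sub>R v)) (at 0)"
    by (auto intro!: derivative_eq_intros)
  ultimately have "((\<lambda>t. f (x + t *\<^sub>R v)) has_derivative (\<lambda>t. (t *\<^sub>R v) \<bullet> D)) (at 0)"
    by (rule has_derivative_compose[rotated])
  then have "((\<lambda>t. f (x + t *\<^sub>R v)) has_field_derivative (v \<bullet> D)) (at 0)"
    unfolding has_field_derivative_def by (rule has_derivative_eq_rhs) (simp add: fun_eq_iff)
  then show "((\<lambda>t. (f (x + t *\<^sub>R v) - f x) / t) \<longlongrightarrow> v \<bullet> D) (at 0)"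
    by (simp add: has_field_derivative_iff)
qed

text \<open>\<open>gradient\<close> is a definite description, from which measurability cannot be
  read off. The directional derivatives of the extension by zero are Borel on the whole space and
  give the gradient wherever it exists in \<open>\<Omega>\<close>; Rademacher's theorem makes the
  other points of \<open>\<Omega>\<close> a null set.\<close>

lemma borel_gradient:
  fixes f :: "'a::euclidean_space \<Rightarrow> real"
  assumes "open \<Omega>" and lip: "locally_lipschitz_on \<Omega> f"
  obtains G N where "G \<in> borel_measurable borel" "N \<in> null_sets lborel"
    "\<And>x. x \<in> \<Omega> - N \<Longrightarrow> GDERIV f x :> G x"
proof -
  define F where "F = (\<lambda>x. indicator \<Omega> x *\<^sub>R f x)"
  have [measurable]: "F \<in> borel_measurable borel"
    unfolding F_def using assms
    by (intro borel_measurable_continuous_on_indicator continuous_on_locally_lipschitz) auto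
  define G where "G = (\<lambda>x. \<Sum>i\<in>Basis. dir_deriv F i x *\<^sub>R i)"
  have G: "G \<in> borel_measurable borel"
    unfolding G_def by measurable
  have "{x \<in> \<Omega>. \<not> (\<exists>D. GDERIV f x :> D)} \<in> null_sets lebesgue"
    using rademacher[OF assms] by (simp add: negligible_iff_null_sets)
  then obtain N where N: "N \<in> null_sets lborel" "{x \<in> \<Omega>. \<not> (\<exists>D. GDERIV f x :> D)} \<subseteq> N"
    unfolding null_sets_completion_iff2 by blast
  have GD: "GDERIV f x :> G x" if x: "x \<in> \<Omega> - N" for x
  proof -
    obtain D where D: "GDERIV f x :> D" using x N(2) by auto
    have "GDERIV F x :> D"
      using D \<open>open \<Omega>\<close> x unfolding gderiv_def
      by (elim has_derivative_transform_within_open[of _ _ _ _ \<Omega>]) (auto simp: F_def)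
    then have "G x = (\<Sum>i\<in>Basis. (D \<bullet> i) *\<^sub>R i)"
      by (simp only: G_def dir_deriv_of_GDERIV[of F x D] inner_commute[of _ D])
    then have "G x = D" by (simp only: euclidean_representation)
    with D show ?thesis by (simp only:)
  qed
  show thesis by (rule that[OF G N(1) GD])
qed

section \<open>Increments along tilted curves and their average over the tilt\<close>

lemma nn_integral_lborel_affine:
  fixes t :: "'a::euclidean_space"
  assumes [measurable]: "g \<in> borel_measurable borel" and c: "c \<noteq> 0"
  shows "(\<integral>\<^sup>+x. g x \<partial>lborel) = ennreal (\<bar>c\<bar> ^ DIM('a)) * (\<integral>\<^sup>+x. g (t + c *\<^sub>R x) \<partial>lborel)"
proof -
  have "(\<integral>\<^sup>+x. g x \<partial>lborel)
      = (\<integral>\<^sup>+x. g x \<partial>density (distr lborel borel (\<lambda>x. t + c *\<^sub>R x)) (\<lambda>_. ennreal (\<bar>c\<bar> ^ DIM('a))))"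
    by (rule arg_cong[where f = "\<lambda>M. nn_integral M g", OF lborel_affine[OF c, of t]])
  also have "\<dots> = (\<integral>\<^sup>+x. ennreal (\<bar>c\<bar> ^ DIM('a)) * g x \<partial>distr lborel borel (\<lambda>x. t + c *\<^sub>R x))"
    by (rule nn_integral_density) simp_all
  also have "\<dots> = (\<integral>\<^sup>+x. ennreal (\<bar>c\<bar> ^ DIM('a)) * g (t + c *\<^sub>R x) \<partial>lborel)"
    by (rule nn_integral_distr) simp_all
  also have "\<dots> = ennreal (\<bar>c\<bar> ^ DIM('a)) * (\<integral>\<^sup>+x. g (t + c *\<^sub>R x) \<partial>lborel)"
    by (rule nn_integral_cmult) simp
  finally show ?thesis .
qed

text \<open>The composition is locally Lipschitz on a compact interval, hence Lipschitz there; the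
  constant may depend on the curve and does not enter the final estimate.\<close>

lemma lipschitz_on_compose_locally_lipschitz:
  fixes \<phi> :: "real \<Rightarrow> 'a::euclidean_space"
  assumes lip: "locally_lipschitz_on \<Omega> f" and \<phi>: "C-lipschitz_on {0..1} \<phi>" "\<phi> ` {0..1} \<subseteq> \<Omega>"
  obtains L where "L-lipschitz_on {0..1} (\<lambda>s. f (\<phi> s))"
proof -
  have "0 \<le> C" using \<phi>(1) by (rule lipschitz_on_nonneg)
  \<comment> \<open>\<open>local_lipschitz\<close> concerns families depending on a parameter; the
    one-point set \<open>{0}\<close> is a dummy parameter space.\<close>
  have "local_lipschitz {0::real} {0..1} (\<lambda>_ s. f (\<phi> s))"
    unfolding local_lipschitz_def
  proof (intro ballI)
    fix s t :: real assume s: "s \<in> {0..1}"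
    then have "\<phi> s \<in> \<Omega>" using \<phi>(2) by auto
    from lip[unfolded locally_lipschitz_on_def, THEN bspec, OF this]
    obtain r L where r: "r > 0" and L: "L-lipschitz_on (ball (\<phi> s) r \<inter> \<Omega>) f"
      by (elim exE conjE) (rule that)
    define u where "u = r / (2 * (C + 1))"
    have u: "u > 0" using r \<open>0 \<le> C\<close> by (simp add: u_def)
    have "\<phi> ` (cball s u \<inter> {0..1}) \<subseteq> ball (\<phi> s) r \<inter> \<Omega>"
    proof (intro subsetI, elim imageE)
      fix p t assume t: "p = \<phi> t" "t \<in> cball s u \<inter> {0..1}"
      have "dist (\<phi> s) (\<phi> t) \<le> C * dist s t"
        using s t by (intro lipschitz_onD[OF \<phi>(1)]) auto
      also have "\<dots> \<le> (C + 1) * u"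
        using t \<open>0 \<le> C\<close> by (intro mult_mono) auto
      also have "\<dots> < r"
      proof -
        have "u * (2 * (C + 1)) = r" using \<open>0 \<le> C\<close> by (simp add: u_def)
        then have "2 * ((C + 1) * u) = r" by (simp only: mult_ac)
        then show ?thesis using r by linarith
      qed
      finally show "p \<in> ball (\<phi> s) r \<inter> \<Omega>"
        using t \<phi>(2) by auto
    qed
    then have "L-lipschitz_on (\<phi> ` (cball s u \<inter> {0..1})) f"
      by (rule lipschitz_on_subset[OF L])
    moreover have "C-lipschitz_on (cball s u \<inter> {0..1}) \<phi>"
      by (rule lipschitz_on_subset[OF \<phi>(1)]) auto
    ultimately have "(L * C)-lipschitz_on (cball s u \<inter> {0..1}) (\<lambda>s. f (\<phi> s))"
      by (intro lipschitz_on_compose2)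
    with u show "\<exists>u>0. \<exists>L. \<forall>t\<in>cball t u \<inter> {0}. L-lipschitz_on (cball s u \<inter> {0..1}) (\<lambda>s. f (\<phi> s))"
      by blast
  qed
  then show thesis
  proof (rule local_lipschitz_compact_implies_lipschitz[where f = "\<lambda>_ s. f (\<phi> s)" and X = "{0..1}" and T = "{0::real}"])
    fix L assume "\<And>t. t \<in> {0::real} \<Longrightarrow> L-lipschitz_on {0..1} (\<lambda>s. f (\<phi> s))"
    then show thesis using that by blast
  qed auto
qed

lemma lipschitz_on_UNIV_borel:
  fixes \<gamma> :: "real \<Rightarrow> 'a::euclidean_space"
  assumes "K-lipschitz_on UNIV \<gamma>"
  shows "\<gamma> \<in> borel_measurable borel"
  using lipschitz_on_continuous_on[OF assms] by (rule borel_measurable_continuous_onI)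

text \<open>For fixed \<open>s > 0\<close> the map from \<open>z\<close> to
  \<open>\<gamma> s + s *\<^sub>R z\<close> is an affine bijection, so only a null set of tilts
  reaches \<open>N\<close>. Fubini exchanges the quantifiers over \<open>s\<close> and
  \<open>z\<close>.\<close>

lemma AE_translated_segment_avoids_null_set:
  fixes \<gamma> :: "real \<Rightarrow> 'a::euclidean_space"
  assumes [measurable]: "\<gamma> \<in> borel_measurable borel" and N: "N \<in> null_sets lborel"
  shows "AE z in lborel. AE s in lborel. s \<in> {0<..1} \<longrightarrow> \<gamma> s + s *\<^sub>R z \<notin> N"
proof -
  have [measurable]: "N \<in> sets borel" using N by (auto simp: null_sets_def)
  have "(\<integral>\<^sup>+z. (\<integral>\<^sup>+s. indicator {0<..1} s * indicator N (\<gamma> s + s *\<^sub>R z) \<partial>lborel) \<partial>lborel)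
      = (\<integral>\<^sup>+s. (\<integral>\<^sup>+z. indicator {0<..1} s * indicator N (\<gamma> s + s *\<^sub>R z) \<partial>lborel) \<partial>lborel)"
    by (rule lborel_pair.Fubini') measurable
  also have "\<dots> = (\<integral>\<^sup>+(s::real). 0 \<partial>lborel)"
  proof (rule nn_integral_cong)
    fix s :: real
    show "(\<integral>\<^sup>+z. indicator {0<..1} s * indicator N (\<gamma> s + s *\<^sub>R z) \<partial>lborel) = (0::ennreal)"
    proof (cases "s \<in> {0<..1}")
      case True
      then have "0 = ennreal (\<bar>s\<bar> ^ DIM('a)) * (\<integral>\<^sup>+z. indicator N (\<gamma> s + s *\<^sub>R z) \<partial>lborel)"
        using nn_integral_lborel_affine[of "indicator N" s "\<gamma> s"] N by (simp add: null_sets_def)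
      with True show ?thesis by (simp add: nn_integral_cmult)
    qed simp
  qed
  finally have "(\<integral>\<^sup>+z. (\<integral>\<^sup>+s. indicator {0<..1} s * indicator N (\<gamma> s + s *\<^sub>R z) \<partial>lborel) \<partial>lborel) = (0::ennreal)"
    by simp
  then have "AE z in lborel. (\<integral>\<^sup>+s. indicator {0<..1} s * indicator N (\<gamma> s + s *\<^sub>R z) \<partial>lborel) = (0::ennreal)"
    by (subst (asm) nn_integral_0_iff_AE) measurable
  then show ?thesis
  proof eventually_elim
    case (elim z)
    then have "AE s in lborel. indicator {0<..1} s * indicator N (\<gamma> s + s *\<^sub>R z) = (0::ennreal)"
      by (subst (asm) nn_integral_0_iff_AE) measurable
    then show ?case
      by eventually_elim (auto split: split_indicator_asm)
  qed
qed

lemma AE_increment_le_integral_gradient: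
  fixes f :: "'a::euclidean_space \<Rightarrow> real" and \<gamma> :: "real \<Rightarrow> 'a"
  assumes lip: "locally_lipschitz_on \<Omega> f"
    and G [measurable]: "G \<in> borel_measurable borel" and N: "N \<in> null_sets lborel"
    and GD: "\<And>x. x \<in> \<Omega> - N \<Longrightarrow> GDERIV f x :> G x"
    and \<gamma>: "K-lipschitz_on UNIV \<gamma>"
    and \<gamma>': "AE s\<in>{0..1} in lebesgue. \<exists>v. (\<gamma> has_vector_derivative v) (at s within {0..1}) \<and> norm v \<le> K"
    and inside: "\<And>s z. \<lbrakk>s \<in> {0..1}; z \<in> ball 0 \<rho>\<rbrakk> \<Longrightarrow> \<gamma> s + s *\<^sub>R z \<in> \<Omega>"
  shows "AE z in lborel. z \<in> ball 0 \<rho> \<longrightarrow> ennreal \<bar>f (\<gamma> 1 + z) - f (\<gamma> 0)\<bar>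
      \<le> ennreal (K + \<rho>) * (\<integral>\<^sup>+s\<in>{0<..1}. ennreal (norm (G (\<gamma> s + s *\<^sub>R z))) \<partial>lborel)"
proof -
  have [measurable]: "\<gamma> \<in> borel_measurable borel"
    using \<gamma> by (rule lipschitz_on_UNIV_borel)
  show ?thesis
    using AE_translated_segment_avoids_null_set[OF _ N, of \<gamma>, simplified]
  proof eventually_elim
    case (elim z)
    show ?case
    proof
      assume z: "z \<in> ball 0 \<rho>"
      define \<phi> where "\<phi> = (\<lambda>s. \<gamma> s + s *\<^sub>R z)"
      have "K \<ge> 0" using \<gamma> by (rule lipschitz_on_nonneg)
      have "(K + norm z)-lipschitz_on {0..1} \<phi>"
      proof (rule lipschitz_onI)
        fix s t :: real
        have "dist (\<phi> s) (\<phi> t) = norm ((\<gamma> s - \<gamma> t) + (s - t) *\<^sub>R z)"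
          by (simp add: \<phi>_def dist_norm algebra_simps)
        also have "\<dots> \<le> norm (\<gamma> s - \<gamma> t) + norm ((s - t) *\<^sub>R z)"
          by (rule norm_triangle_ineq)
        also have "norm (\<gamma> s - \<gamma> t) \<le> K * dist s t"
          using lipschitz_onD[OF \<gamma>, of s t] by (simp add: dist_norm)
        also have "norm ((s - t) *\<^sub>R z) = norm z * dist s t"
          by (simp only: norm_scaleR dist_norm real_norm_def mult.commute)
        finally show "dist (\<phi> s) (\<phi> t) \<le> (K + norm z) * dist s t"
          by (simp add: distrib_right)
      qed (use \<open>K \<ge> 0\<close> in simp)
      moreover have "\<phi> ` {0..1} \<subseteq> \<Omega>"
        using inside z by (auto simp: \<phi>_def)
      ultimately obtain L where L: "L-lipschitz_on {0..1} (\<lambda>s. f (\<phi> s))"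
        using lipschitz_on_compose_locally_lipschitz[OF lip] by blast
      have "AE s in lebesgue. s \<in> {0<..1} \<longrightarrow> \<phi> s \<notin> N"
        using AE_completion[OF elim] by (simp add: \<phi>_def)
      \<comment> \<open>At \<open>s = 0\<close> every tilted curve passes through
        \<open>\<gamma> 0\<close>, which may belong to \<open>N\<close>.\<close>
      moreover have "AE s in lebesgue. s \<noteq> (0::real)"
        by (intro AE_completion AE_lborel_singleton)
      ultimately have "AE s\<in>{0..1} in lebesgue. \<exists>v. ((\<lambda>s. f (\<phi> s)) has_vector_derivative v) (at s within {0..1})
          \<and> ennreal \<bar>v\<bar> \<le> ennreal ((K + \<rho>) * norm (G (\<phi> s)))"
        using \<gamma>'
      proof eventually_elim
        case (elim s)
        show ?case
        proof
          assume s: "s \<in> {0..1}"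
          with elim obtain v where v: "(\<gamma> has_vector_derivative v) (at s within {0..1})" "norm v \<le> K" by blast
          have "\<phi> s \<in> \<Omega> - N"
            using inside[OF s z] elim s by (auto simp: \<phi>_def)
          then have "(f has_derivative (\<lambda>h. h \<bullet> G (\<phi> s))) (at (\<phi> s))"
            using GD by (simp add: gderiv_def)
          moreover have "(\<phi> has_derivative (\<lambda>t. t *\<^sub>R (v + z))) (at s within {0..1})"
            unfolding \<phi>_def using v(1) unfolding has_vector_derivative_def
            by (auto intro!: derivative_eq_intros simp: scaleR_right_distrib)
          ultimately have "((\<lambda>s. f (\<phi> s)) has_derivative (\<lambda>t. (t *\<^sub>R (v + z)) \<bullet> G (\<phi> s))) (at s within {0..1})"
            by (rule has_derivative_compose[rotated])
          then have "((\<lambda>s. f (\<phi> s)) has_vector_derivative ((v + z) \<bullet> G (\<phi> s))) (at s within {0..1})"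
            unfolding has_vector_derivative_def by simp
          moreover have "\<bar>(v + z) \<bullet> G (\<phi> s)\<bar> \<le> (K + \<rho>) * norm (G (\<phi> s))"
          proof -
            have "\<bar>(v + z) \<bullet> G (\<phi> s)\<bar> \<le> norm (v + z) * norm (G (\<phi> s))"
              by (rule Cauchy_Schwarz_ineq2)
            also have "\<dots> \<le> (K + \<rho>) * norm (G (\<phi> s))"
              using norm_triangle_ineq[of v z] v(2) z by (intro mult_right_mono) auto
            finally show ?thesis .
          qed
          ultimately show "\<exists>v. ((\<lambda>s. f (\<phi> s)) has_vector_derivative v) (at s within {0..1})
              \<and> ennreal \<bar>v\<bar> \<le> ennreal ((K + \<rho>) * norm (G (\<phi> s)))"
            by (blast intro: ennreal_leI)
        qed
      qed
      from lipschitz_increment_le_nn_integral[OF L this]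
      have "ennreal \<bar>f (\<gamma> 1 + z) - f (\<gamma> 0)\<bar> \<le> (\<integral>\<^sup>+s\<in>{0..1}. ennreal ((K + \<rho>) * norm (G (\<phi> s))) \<partial>lebesgue)"
        by (simp add: \<phi>_def)
      also have "\<dots> = (\<integral>\<^sup>+s. ennreal (K + \<rho>) * (ennreal (norm (G (\<phi> s))) * indicator {0<..1} s) \<partial>lborel)"
        unfolding nn_integral_completion
      proof (rule nn_integral_cong_AE)
        have "AE s in lborel. s \<noteq> (0::real)" by (rule AE_lborel_singleton)
        then show "AE s in lborel. ennreal ((K + \<rho>) * norm (G (\<phi> s))) * indicator {0..1} s
            = ennreal (K + \<rho>) * (ennreal (norm (G (\<phi> s))) * indicator {0<..1} s)"
        proof eventually_elim
          case (elim s)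
          have "norm z < \<rho>" using z by simp
          then have "0 \<le> K + \<rho>" using \<open>K \<ge> 0\<close> norm_ge_zero[of z] by linarith
          with elim show ?case
            by (auto simp: ennreal_mult' split: split_indicator)
        qed
      qed
      also have "\<dots> = ennreal (K + \<rho>) * (\<integral>\<^sup>+s\<in>{0<..1}. ennreal (norm (G (\<phi> s))) \<partial>lborel)"
        unfolding \<phi>_def by (rule nn_integral_cmult) measurable
      finally show "ennreal \<bar>f (\<gamma> 1 + z) - f (\<gamma> 0)\<bar>
          \<le> ennreal (K + \<rho>) * (\<integral>\<^sup>+s\<in>{0<..1}. ennreal (norm (G (\<gamma> s + s *\<^sub>R z))) \<partial>lborel)"
        by (simp add: \<phi>_def)
    qed
  qed
qed

text \<open>The conditions hold for every point \<open>x = \<gamma> s + s z\<close> reached by a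
  tilt \<open>norm z < \<rho>\<close> from a curve that starts at \<open>y\<close>, and the power of
  \<open>s\<close> is the Jacobian of that substitution in \<open>z\<close>. No curve occurs, so the
  order of integration in \<open>x\<close> and \<open>y\<close> can be exchanged.\<close>

definition john_kernel :: "'a::euclidean_space set \<Rightarrow> ('a \<Rightarrow> 'a) \<Rightarrow> real \<Rightarrow> real \<Rightarrow> real \<Rightarrow> 'a \<Rightarrow> 'a \<Rightarrow> ennreal" where
  "john_kernel \<Omega> G \<rho> C s x y =
    (if 0 < s \<and> s \<le> 1 \<and> \<rho> * s \<le> boundary_dist \<Omega> x \<and> dist x y < C * s
     then ennreal (norm (G x) / s ^ DIM('a)) * indicator \<Omega> x else 0)"

lemma borel_measurable_john_kernel:
  fixes G :: "'a::euclidean_space \<Rightarrow> 'a"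
  assumes [measurable]: "\<Omega> \<in> sets borel" "G \<in> borel_measurable borel"
  shows "(\<lambda>(s, x, y). john_kernel \<Omega> G \<rho> C s x y) \<in> borel_measurable borel"
  unfolding john_kernel_def borel_prod[symmetric] by measurable

text \<open>The bound for almost every tilt is integrated over \<open>z\<close> and the integrals
  are exchanged. For each fixed \<open>s\<close>, substituting \<open>x = \<gamma> s + s z\<close>
  then turns the average into an integral of the kernel.\<close>

lemma nn_integral_increments_le:
  fixes f :: "'a::euclidean_space \<Rightarrow> real" and \<gamma> :: "real \<Rightarrow> 'a"
  assumes "open \<Omega>" and lip: "locally_lipschitz_on \<Omega> f"
    and G [measurable]: "G \<in> borel_measurable borel" and N: "N \<in> null_sets lborel"
    and GD: "\<And>x. x \<in> \<Omega> - N \<Longrightarrow> GDERIV f x :> G x"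
    and \<gamma>: "K-lipschitz_on UNIV \<gamma>"
    and \<gamma>': "AE s\<in>{0..1} in lebesgue. \<exists>v. (\<gamma> has_vector_derivative v) (at s within {0..1}) \<and> norm v \<le> K"
    and "\<rho> > 0" and \<gamma>_\<Omega>: "\<And>s. s \<in> {0..1} \<Longrightarrow> \<gamma> s \<in> \<Omega> \<and> 2 * \<rho> * s \<le> boundary_dist \<Omega> (\<gamma> s)"
  shows "(\<integral>\<^sup>+z\<in>ball 0 \<rho>. ennreal \<bar>f (\<gamma> 0) - f (\<gamma> 1 + z)\<bar> \<partial>lborel)
    \<le> ennreal (K + \<rho>) * (\<integral>\<^sup>+s. (\<integral>\<^sup>+x. john_kernel \<Omega> G \<rho> (K + \<rho>) s x (\<gamma> 0) \<partial>lborel) \<partial>lborel)"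
proof -
  have [measurable]: "\<gamma> \<in> borel_measurable borel"
    using \<gamma> by (rule lipschitz_on_UNIV_borel)
  have [measurable]: "\<Omega> \<in> sets borel" using \<open>open \<Omega>\<close> by simp
  have [measurable]: "ball 0 \<rho> \<in> sets (borel :: 'a measure)" by simp
  have "K \<ge> 0" using \<gamma> by (rule lipschitz_on_nonneg)
  have inside: "\<gamma> s + s *\<^sub>R z \<in> \<Omega>" if s: "s \<in> {0..1}" and z: "z \<in> ball 0 \<rho>" for s z
  proof (cases "s = 0")
    case True
    then show ?thesis using \<gamma>_\<Omega>[of 0] by simp
  next
    case False
    have "s * norm z < s * (2 * \<rho>)"
      using s z False \<open>\<rho> > 0\<close> by (intro mult_strict_left_mono) auto
    then have sz: "norm (s *\<^sub>R z) < 2 * \<rho> * s"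
      using s by (simp add: mult_ac)
    show ?thesis
    proof (rule mem_of_norm_less_boundary_dist[rotated])
      show "norm (\<gamma> s + s *\<^sub>R z - \<gamma> s) < boundary_dist \<Omega> (\<gamma> s)"
        using \<gamma>_\<Omega>[OF s] sz by simp
    qed (use \<gamma>_\<Omega>[OF s] in simp)
  qed
  have ae: "AE z in lborel. z \<in> ball 0 \<rho> \<longrightarrow> ennreal \<bar>f (\<gamma> 1 + z) - f (\<gamma> 0)\<bar>
      \<le> ennreal (K + \<rho>) * (\<integral>\<^sup>+s\<in>{0<..1}. ennreal (norm (G (\<gamma> s + s *\<^sub>R z))) \<partial>lborel)"
    by (rule AE_increment_le_integral_gradient[OF lip G N GD \<gamma> \<gamma>' inside])
  have "(\<integral>\<^sup>+z\<in>ball 0 \<rho>. ennreal \<bar>f (\<gamma> 0) - f (\<gamma> 1 + z)\<bar> \<partial>lborel)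
      \<le> (\<integral>\<^sup>+z. ennreal (K + \<rho>) * (\<integral>\<^sup>+s. ennreal (norm (G (\<gamma> s + s *\<^sub>R z))) * indicator {0<..1} s * indicator (ball 0 \<rho>) z \<partial>lborel) \<partial>lborel)"
  proof (rule nn_integral_mono_AE)
    show "AE z in lborel. ennreal \<bar>f (\<gamma> 0) - f (\<gamma> 1 + z)\<bar> * indicator (ball 0 \<rho>) z
      \<le> ennreal (K + \<rho>) * (\<integral>\<^sup>+s. ennreal (norm (G (\<gamma> s + s *\<^sub>R z))) * indicator {0<..1} s * indicator (ball 0 \<rho>) z \<partial>lborel)"
      using ae
    proof eventually_elim
      case (elim z)
      then show ?case
        by (cases "z \<in> ball 0 \<rho>") (simp_all add: abs_minus_commute[of "f (\<gamma> 0)"])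
    qed
  qed
  also have "\<dots> = ennreal (K + \<rho>) * (\<integral>\<^sup>+z. (\<integral>\<^sup>+s. ennreal (norm (G (\<gamma> s + s *\<^sub>R z))) * indicator {0<..1} s * indicator (ball 0 \<rho>) z \<partial>lborel) \<partial>lborel)"
    by (rule nn_integral_cmult) measurable
  also have "(\<integral>\<^sup>+z. (\<integral>\<^sup>+s. ennreal (norm (G (\<gamma> s + s *\<^sub>R z))) * indicator {0<..1} s * indicator (ball 0 \<rho>) z \<partial>lborel) \<partial>lborel)
     = (\<integral>\<^sup>+s. (\<integral>\<^sup>+z. ennreal (norm (G (\<gamma> s + s *\<^sub>R z))) * indicator {0<..1} s * indicator (ball 0 \<rho>) z \<partial>lborel) \<partial>lborel)"
    by (rule lborel_pair.Fubini') measurable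
  also have "\<dots> \<le> (\<integral>\<^sup>+s. (\<integral>\<^sup>+x. john_kernel \<Omega> G \<rho> (K + \<rho>) s x (\<gamma> 0) \<partial>lborel) \<partial>lborel)"
    (is "_ \<le> (\<integral>\<^sup>+s. (\<integral>\<^sup>+x. ?F s x \<partial>lborel) \<partial>lborel)")
  proof (rule nn_integral_mono)
    fix s :: real
    show "(\<integral>\<^sup>+z. ennreal (norm (G (\<gamma> s + s *\<^sub>R z))) * indicator {0<..1} s * indicator (ball 0 \<rho>) z \<partial>lborel) \<le> (\<integral>\<^sup>+x. ?F s x \<partial>lborel)"
    proof (cases "s \<in> {0<..1}")
      case True
      then have "s > 0" "s \<in> {0..1}" by auto
      have [measurable]: "(\<lambda>x. ?F s x) \<in> borel_measurable borel"
        unfolding john_kernel_def by measurable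
      have "(\<integral>\<^sup>+z. ennreal (norm (G (\<gamma> s + s *\<^sub>R z))) * indicator {0<..1} s * indicator (ball 0 \<rho>) z \<partial>lborel)
          \<le> (\<integral>\<^sup>+z. ennreal (s ^ DIM('a)) * ?F s (\<gamma> s + s *\<^sub>R z) \<partial>lborel)"
      proof (rule nn_integral_mono)
        fix z
        show "ennreal (norm (G (\<gamma> s + s *\<^sub>R z))) * indicator {0<..1} s * indicator (ball 0 \<rho>) z
            \<le> ennreal (s ^ DIM('a)) * ?F s (\<gamma> s + s *\<^sub>R z)"
        proof (cases "z \<in> ball 0 \<rho>")
          case z: True
          let ?x = "\<gamma> s + s *\<^sub>R z"
          have sz: "norm (s *\<^sub>R z) < s * \<rho>" using z \<open>s > 0\<close> by simp
          have 1: "?x \<in> \<Omega>" by (rule inside) (use \<open>s \<in> {0..1}\<close> z in auto)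
          \<comment> \<open>The clearance at \<open>\<gamma> s\<close> is twice
            \<open>\<rho> * s\<close>; the tilt uses up less than half of it, so
            \<open>\<rho> * s\<close> remains at \<open>?x\<close>.\<close>
          have "2 * \<rho> * s \<le> boundary_dist \<Omega> ?x + dist (\<gamma> s) ?x"
            using \<gamma>_\<Omega>[OF \<open>s \<in> {0..1}\<close>] boundary_dist_le[of \<Omega> "\<gamma> s" ?x] by linarith
          moreover have "dist (\<gamma> s) ?x = norm (s *\<^sub>R z)" by (simp add: dist_norm)
          ultimately have 2: "\<rho> * s \<le> boundary_dist \<Omega> ?x"
            using sz by (simp only: mult_ac)
          have "dist ?x (\<gamma> 0) \<le> dist ?x (\<gamma> s) + dist (\<gamma> s) (\<gamma> 0)" by (rule dist_triangle)
          also have "dist (\<gamma> s) (\<gamma> 0) \<le> K * s"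
            using lipschitz_onD[OF \<gamma>, of s 0] \<open>s > 0\<close> by simp
          also have "dist ?x (\<gamma> s) < s * \<rho>"
            using sz by (simp add: dist_norm)
          finally have 3: "dist ?x (\<gamma> 0) < (K + \<rho>) * s"
            by (simp add: algebra_simps)
          have "ennreal (s ^ DIM('a)) * ennreal (norm (G ?x) / s ^ DIM('a)) = ennreal (norm (G ?x))"
            using \<open>s > 0\<close> by (simp add: ennreal_mult'[symmetric])
          then have "ennreal (s ^ DIM('a)) * ?F s ?x = ennreal (norm (G ?x))"
            unfolding john_kernel_def using 1 2 3 True by simp
          with True z show ?thesis by simp
        qed simp
      qed
      also have "\<dots> = ennreal (s ^ DIM('a)) * (\<integral>\<^sup>+z. ?F s (\<gamma> s + s *\<^sub>R z) \<partial>lborel)"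
        by (rule nn_integral_cmult) measurable
      also have "\<dots> = (\<integral>\<^sup>+x. ?F s x \<partial>lborel)"
        using nn_integral_lborel_affine[of "\<lambda>x. ?F s x" s "\<gamma> s"] \<open>s > 0\<close> by simp
      finally show ?thesis .
    qed simp
  qed
  finally show ?thesis by (simp add: mult_left_mono)
qed

text \<open>Brings the integration over \<open>y\<close> to the inside, where the weight will meet
  the maximal function at a fixed \<open>x\<close>.\<close>

lemma tonelli_rotate:
  fixes F :: "'s::euclidean_space \<Rightarrow> 'x::euclidean_space \<Rightarrow> 'y::euclidean_space \<Rightarrow> ennreal"
  assumes F [measurable]: "(\<lambda>(s, x, y). F s x y) \<in> borel_measurable borel"
  shows "(\<integral>\<^sup>+y. (\<integral>\<^sup>+s. (\<integral>\<^sup>+x. F s x y \<partial>lborel) \<partial>lborel) \<partial>lborel)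
       = (\<integral>\<^sup>+x. (\<integral>\<^sup>+s. (\<integral>\<^sup>+y. F s x y \<partial>lborel) \<partial>lborel) \<partial>lborel)"
proof -
  have F' [measurable]: "(\<lambda>x. F (a x) (b x) (c x)) \<in> borel_measurable M"
    if [measurable]: "a \<in> borel_measurable M" "b \<in> borel_measurable M" "c \<in> borel_measurable M" for a b c M
    using measurable_compose[of "\<lambda>x. (a x, b x, c x)" M borel "\<lambda>(s, x, y). F s x y" borel] F by simp
  have "(\<integral>\<^sup>+y. (\<integral>\<^sup>+s. (\<integral>\<^sup>+x. F s x y \<partial>lborel) \<partial>lborel) \<partial>lborel)
      = (\<integral>\<^sup>+s. (\<integral>\<^sup>+y. (\<integral>\<^sup>+x. F s x y \<partial>lborel) \<partial>lborel) \<partial>lborel)"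
    by (rule lborel_pair.Fubini') measurable
  also have "\<dots> = (\<integral>\<^sup>+s. (\<integral>\<^sup>+x. (\<integral>\<^sup>+y. F s x y \<partial>lborel) \<partial>lborel) \<partial>lborel)"
    by (intro nn_integral_cong lborel_pair.Fubini') measurable
  also have "\<dots> = (\<integral>\<^sup>+x. (\<integral>\<^sup>+s. (\<integral>\<^sup>+y. F s x y \<partial>lborel) \<partial>lborel) \<partial>lborel)"
    by (rule lborel_pair.Fubini') measurable
  finally show ?thesis .
qed

subsection \<open>The weighted inequality\<close>

text \<open>Puts the curves into the form used below: Lipschitz on the whole line, with a
  nonnegative constant, and with the clearance written as \<open>2 * \<rho> * s\<close> so that half
  of it is left for the tilt.\<close>

lemma john_domainE:
  fixes \<Omega> :: "'a::euclidean_space set"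
  assumes "john_domain \<Omega>"
  obtains x0 \<rho> K where "open \<Omega>" "\<rho> > 0" "K \<ge> 0" "ball x0 \<rho> \<subseteq> \<Omega>"
    "\<And>y. y \<in> \<Omega> \<Longrightarrow> \<exists>\<gamma>. K-lipschitz_on UNIV \<gamma> \<and>
       (AE s\<in>{0..1} in lebesgue. \<exists>v. (\<gamma> has_vector_derivative v) (at s within {0..1}) \<and> norm v \<le> K) \<and>
       \<gamma> 0 = y \<and> \<gamma> 1 = x0 \<and> (\<forall>s\<in>{0..1}. \<gamma> s \<in> \<Omega> \<and> 2 * \<rho> * s \<le> boundary_dist \<Omega> (\<gamma> s))"
proof -
  from assms obtain x0 \<delta> K0 where "open \<Omega>" "x0 \<in> \<Omega>" "\<delta> > 0" and curves: "\<forall>y\<in>\<Omega>. \<exists>\<gamma>.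
        rectifiable_curve \<gamma> \<and> absolutely_continuous_curve \<gamma> \<and> path_image \<gamma> \<subseteq> \<Omega> \<and>
        \<gamma> 0 = y \<and> \<gamma> 1 = x0 \<and>
        (\<forall>s\<in>{0..1}. \<delta> * s \<le> boundary_dist \<Omega> (\<gamma> s)) \<and>
        (AE s\<in>{0..1} in lebesgue.
           \<exists>v. (\<gamma> has_vector_derivative v) (at s within {0..1}) \<and> norm v \<le> K0)"
    unfolding john_domain_def by (elim conjE bexE exE) (rule that)
  define \<rho> K where "\<rho> = \<delta> / 2" and "K = max K0 0"
  have lipcurves: "\<exists>\<gamma>. K-lipschitz_on UNIV \<gamma> \<and>
       (AE s\<in>{0..1} in lebesgue. \<exists>v. (\<gamma> has_vector_derivative v) (at s within {0..1}) \<and> norm v \<le> K) \<and>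
       \<gamma> 0 = y \<and> \<gamma> 1 = x0 \<and> (\<forall>s\<in>{0..1}. \<gamma> s \<in> \<Omega> \<and> 2 * \<rho> * s \<le> boundary_dist \<Omega> (\<gamma> s))"
    if y: "y \<in> \<Omega>" for y
  proof -
    from curves[THEN bspec, OF y] obtain \<gamma> where \<gamma>: "absolutely_continuous_curve \<gamma>" "path_image \<gamma> \<subseteq> \<Omega>"
        "\<gamma> 0 = y" "\<gamma> 1 = x0" "\<forall>s\<in>{0..1}. \<delta> * s \<le> boundary_dist \<Omega> (\<gamma> s)"
        "AE s\<in>{0..1} in lebesgue. \<exists>v. (\<gamma> has_vector_derivative v) (at s within {0..1}) \<and> norm v \<le> K0"
      by (elim exE conjE) (rule that)
    have \<gamma>': "AE s\<in>{0..1} in lebesgue. \<exists>v. (\<gamma> has_vector_derivative v) (at s within {0..1}) \<and> norm v \<le> K"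
      using \<gamma>(6) by (rule eventually_mono) (auto simp: K_def intro: le_max_iff_disj[THEN iffD2])
    have lip: "K-lipschitz_on {0..1} \<gamma>"
      using \<gamma>(1) \<gamma>' by (intro lipschitz_of_absolutely_continuous_curve) (auto simp: K_def)
    \<comment> \<open>Extending the curve by its constant end values makes it Lipschitz, hence
      Borel, on the whole line.\<close>
    define \<eta> where "\<eta> = (\<lambda>s. \<gamma> (max 0 (min 1 s)))"
    have eq: "\<eta> s = \<gamma> s" if "s \<in> {0..1}" for s
      using that by (simp add: \<eta>_def)
    have "K-lipschitz_on UNIV \<eta>"
    proof (rule lipschitz_onI)
      fix s t :: real
      have "dist (\<eta> s) (\<eta> t) \<le> K * dist (max 0 (min 1 s)) (max 0 (min 1 t))"
        unfolding \<eta>_def by (intro lipschitz_onD[OF lip]) auto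
      also have "\<dots> \<le> K * dist s t"
        by (intro mult_left_mono) (auto simp: dist_real_def K_def)
      finally show "dist (\<eta> s) (\<eta> t) \<le> K * dist s t" .
    qed (simp add: K_def)
    moreover have "AE s\<in>{0..1} in lebesgue. \<exists>v. (\<eta> has_vector_derivative v) (at s within {0..1}) \<and> norm v \<le> K"
      using \<gamma>'
    proof eventually_elim
      case (elim s)
      then show ?case
        using has_vector_derivative_transform[of s "{0..1}" \<eta> \<gamma>] eq by blast
    qed
    moreover have "\<eta> 0 = y" "\<eta> 1 = x0"
      using \<gamma>(3,4) by (simp_all add: eq)
    moreover have "\<eta> s \<in> \<Omega> \<and> 2 * \<rho> * s \<le> boundary_dist \<Omega> (\<eta> s)" if "s \<in> {0..1}" for s
      using that \<gamma>(2,5) by (auto simp: eq \<rho>_def path_image_def)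
    ultimately show ?thesis by blast
  qed
  \<comment> \<open>Any of the curves ends at \<open>x0\<close>, so its clearance at
    \<open>s = 1\<close> bounds the distance of \<open>x0\<close> to the boundary from
    below.\<close>
  obtain \<gamma> where "\<gamma> 1 = x0" "\<forall>s\<in>{0..1}. \<gamma> s \<in> \<Omega> \<and> 2 * \<rho> * s \<le> boundary_dist \<Omega> (\<gamma> s)"
    using lipcurves[OF \<open>x0 \<in> \<Omega>\<close>] by (elim exE conjE) (rule that)
  then have "2 * \<rho> \<le> boundary_dist \<Omega> x0"
    by (auto dest: bspec[of _ _ 1])
  then have "ball x0 \<rho> \<subseteq> \<Omega>"
    using \<open>x0 \<in> \<Omega>\<close> \<open>\<delta> > 0\<close>
    by (auto simp: dist_norm norm_minus_commute \<rho>_def intro!: mem_of_norm_less_boundary_dist[OF \<open>x0 \<in> \<Omega>\<close>])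
  show thesis
  proof (rule that[of \<rho> K x0])
  qed (fact | use \<open>\<delta> > 0\<close> in \<open>simp add: \<rho>_def K_def\<close> | rule lipcurves)+
qed

section \<open>Integrating the kernel against the weight\<close>

lemma nn_integral_ball_le_maximal_function:
  fixes w :: "'a::euclidean_space \<Rightarrow> real"
  assumes "r > 0" and W: "AE y in lborel. ennreal (norm (w y)) = W y"
  shows "(\<integral>\<^sup>+y\<in>ball x r. W y \<partial>lborel)
    \<le> maximal_function w x * ennreal (unit_ball_vol (DIM('a)) * r ^ DIM('a))"
proof -
  let ?I = "\<integral>\<^sup>+y\<in>ball x r. ennreal (norm (w y)) \<partial>lebesgue" and ?\<mu> = "emeasure lebesgue (ball x r)"
  have \<mu>: "?\<mu> = ennreal (unit_ball_vol (DIM('a)) * r ^ DIM('a))"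
    using \<open>r > 0\<close> by (simp add: emeasure_ball)
  have pos: "unit_ball_vol (DIM('a)) * r ^ DIM('a) > 0"
    using \<open>r > 0\<close> by simp
  have "(\<integral>\<^sup>+y\<in>ball x r. W y \<partial>lborel) = ?I"
    unfolding nn_integral_completion using W by (intro nn_integral_cong_AE) (auto elim: eventually_mono)
  \<comment> \<open>Valid in \<open>ennreal\<close> because the measure of the ball is neither zero
    nor infinite.\<close>
  also have "\<dots> = ?I / ?\<mu> * ?\<mu>"
  proof -
    have "?\<mu> \<noteq> 0" using pos by (simp only: \<mu> ennreal_eq_0_iff not_le)
    moreover have "?\<mu> \<noteq> top" by (simp only: \<mu> ennreal_neq_top not_False_eq_True)
    ultimately show ?thesis
      by (metis ennreal_times_divide mult.commute mult_divide_eq_ennreal)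
  qed
  also have "?I / ?\<mu> \<le> maximal_function w x"
    unfolding maximal_function_def using \<open>r > 0\<close> by (intro SUP_upper) simp
  finally show ?thesis by (simp add: \<mu> mult_right_mono)
qed

text \<open>For fixed \<open>s\<close>, \<open>y\<close> ranges over a ball of radius
  \<open>C * s\<close>, whose volume cancels the power of \<open>s\<close> in the kernel. What
  remains is constant in \<open>s\<close>, and the condition
  \<open>\<rho> * s \<le> boundary_dist \<Omega> x\<close> confines \<open>s\<close> to an interval
  of length \<open>boundary_dist \<Omega> x / \<rho>\<close>.\<close>

lemma nn_integral_john_kernel_le:
  fixes w :: "'a::euclidean_space \<Rightarrow> real" and G :: "'a \<Rightarrow> 'a"
  assumes "\<rho> > 0" "C > 0" and [measurable]: "W \<in> borel_measurable borel"
    and W: "AE y in lborel. ennreal (norm (w y)) = W y"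
  shows "(\<integral>\<^sup>+s. (\<integral>\<^sup>+y. W y * john_kernel \<Omega> G \<rho> C s x y \<partial>lborel) \<partial>lborel)
    \<le> ennreal (unit_ball_vol (DIM('a)) * C ^ DIM('a) / \<rho>)
       * (ennreal (boundary_dist \<Omega> x * norm (G x)) * indicator \<Omega> x * maximal_function w x)"
proof -
  define V where "V = unit_ball_vol (DIM('a)) * C ^ DIM('a)"
  have [measurable]: "ball x r \<in> sets borel" for r by simp
  have V: "V \<ge> 0" using \<open>C > 0\<close> by (simp add: V_def)
  have d: "0 \<le> boundary_dist \<Omega> x" by (simp add: boundary_dist_def infdist_nonneg)
  let ?M = "maximal_function w x"
  let ?c = "ennreal (norm (G x) * V) * indicator \<Omega> x * ?M"
  have inner: "(\<integral>\<^sup>+y. W y * john_kernel \<Omega> G \<rho> C s x y \<partial>lborel)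
      \<le> ?c * indicator {0..boundary_dist \<Omega> x / \<rho>} s" for s
  proof (cases "0 < s \<and> s \<le> 1 \<and> \<rho> * s \<le> boundary_dist \<Omega> x")
    case True
    then have "s > 0" by simp
    have "(\<integral>\<^sup>+y. W y * john_kernel \<Omega> G \<rho> C s x y \<partial>lborel)
        = (\<integral>\<^sup>+y. ennreal (norm (G x) / s ^ DIM('a)) * indicator \<Omega> x * (W y * indicator (ball x (C * s)) y) \<partial>lborel)"
      using True by (intro nn_integral_cong) (simp add: john_kernel_def indicator_def mult_ac)
    also have "\<dots> = ennreal (norm (G x) / s ^ DIM('a)) * indicator \<Omega> x * (\<integral>\<^sup>+y\<in>ball x (C * s). W y \<partial>lborel)"
      by (rule nn_integral_cmult) simp
    also have "\<dots> \<le> ennreal (norm (G x) / s ^ DIM('a)) * indicator \<Omega> x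
        * (?M * ennreal (unit_ball_vol (DIM('a)) * (C * s) ^ DIM('a)))"
      using \<open>C > 0\<close> \<open>s > 0\<close> by (intro mult_left_mono nn_integral_ball_le_maximal_function[OF _ W]) auto
    also have "\<dots> = (ennreal (norm (G x) / s ^ DIM('a)) * ennreal (unit_ball_vol (DIM('a)) * (C * s) ^ DIM('a)))
        * indicator \<Omega> x * ?M"
      by (simp only: mult_ac)
    also have "ennreal (norm (G x) / s ^ DIM('a)) * ennreal (unit_ball_vol (DIM('a)) * (C * s) ^ DIM('a))
        = ennreal (norm (G x) * V)"
      using \<open>s > 0\<close> \<open>C > 0\<close> by (simp add: ennreal_mult'[symmetric] V_def power_mult_distrib)
    finally show ?thesis
      using True \<open>\<rho> > 0\<close> by (simp add: field_simps)
  next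
    case False
    then show ?thesis by (auto simp: john_kernel_def)
  qed
  have "(\<integral>\<^sup>+s. (\<integral>\<^sup>+y. W y * john_kernel \<Omega> G \<rho> C s x y \<partial>lborel) \<partial>lborel)
      \<le> (\<integral>\<^sup>+s. ?c * indicator {0..boundary_dist \<Omega> x / \<rho>} s \<partial>lborel)"
    by (intro nn_integral_mono inner)
  also have "\<dots> = ?c * ennreal (boundary_dist \<Omega> x / \<rho>)"
    using d \<open>\<rho> > 0\<close> by (subst nn_integral_cmult_indicator) auto
  also have "\<dots> = (ennreal (norm (G x) * V) * ennreal (boundary_dist \<Omega> x / \<rho>)) * (indicator \<Omega> x * ?M)"
    by (simp only: mult_ac)
  also have "ennreal (norm (G x) * V) * ennreal (boundary_dist \<Omega> x / \<rho>)
      = ennreal (V / \<rho>) * ennreal (boundary_dist \<Omega> x * norm (G x))"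
    using d V \<open>\<rho> > 0\<close> by (simp add: ennreal_mult'[symmetric] mult_ac)
  finally show ?thesis by (simp add: V_def mult_ac)
qed

theorem theorem4p2:
  fixes \<Omega> :: "(real ^ 'n) set"
    and w1 w2 :: "real ^ 'n \<Rightarrow> real"
  assumes "john_domain \<Omega>"
    and "w1 \<in> borel_measurable lebesgue" and "\<And>x. 0 \<le> w1 x"
    and "w2 \<in> borel_measurable lebesgue" and "\<And>x. 0 \<le> w2 x"
    and "\<exists>K::ennreal. K < \<infinity> \<and>
           (AE x in lebesgue. maximal_function w1 x \<le> K * ennreal (w2 x))"
  shows "\<exists>C>0. \<forall>f :: real ^ 'n \<Rightarrow> real. locally_lipschitz_on \<Omega> f \<longrightarrow>
           (INF a::real. L1_norm_on \<Omega> (\<lambda>x. (f x - a) * w1 x))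
             \<le> ennreal C *
                L1_norm_on \<Omega> (\<lambda>x. (boundary_dist \<Omega> x * w2 x) *\<^sub>R gradient f x)"
proof -
  let ?n = "DIM(real ^ 'n)"
  from \<open>john_domain \<Omega>\<close> obtain x0 \<rho> K where "open \<Omega>" "\<rho> > 0" "K \<ge> 0" and x0: "ball x0 \<rho> \<subseteq> \<Omega>"
    and curves: "\<And>y. y \<in> \<Omega> \<Longrightarrow> \<exists>\<gamma>. K-lipschitz_on UNIV \<gamma> \<and>
       (AE s\<in>{0..1} in lebesgue. \<exists>v. (\<gamma> has_vector_derivative v) (at s within {0..1}) \<and> norm v \<le> K) \<and>
       \<gamma> 0 = y \<and> \<gamma> 1 = x0 \<and> (\<forall>s\<in>{0..1}. \<gamma> s \<in> \<Omega> \<and> 2 * \<rho> * s \<le> boundary_dist \<Omega> (\<gamma> s))"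
    by (rule john_domainE) (rule that)
  obtain \<kappa> where \<kappa>: "0 \<le> \<kappa>" and max: "AE x in lebesgue. maximal_function w1 x \<le> ennreal \<kappa> * ennreal (w2 x)"
  proof -
    obtain K' :: ennreal where K': "K' < \<infinity>" "AE x in lebesgue. maximal_function w1 x \<le> K' * ennreal (w2 x)"
      using assms(6) by blast
    then show thesis using that[of "enn2real K'"] by simp
  qed
  \<comment> \<open>The weight is only Lebesgue measurable, while the exchanges of integrals take
    place over \<open>lborel\<close>; \<open>W\<close> is a Borel representative.\<close>
  obtain W where W [measurable]: "W \<in> borel_measurable borel" and W_eq: "AE y in lborel. ennreal (norm (w1 y)) = W y"
    using completion_ex_borel_measurable[of "\<lambda>y. ennreal (norm (w1 y))" lborel] assms(2) by auto
  have [measurable]: "\<Omega> \<in> sets borel" using \<open>open \<Omega>\<close> by simp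
  have [measurable]: "ball 0 \<rho> \<in> sets (borel :: (real ^ 'n) measure)" by simp
  define C where "C = K + \<rho>"
  have "C > 0" using \<open>\<rho> > 0\<close> \<open>K \<ge> 0\<close> by (simp add: C_def)
  define A where "A = unit_ball_vol ?n * C ^ ?n / \<rho>"
  define B where "B = unit_ball_vol ?n * \<rho> ^ ?n"
  have "A \<ge> 0" "B > 0" using \<open>C > 0\<close> \<open>\<rho> > 0\<close> by (simp_all add: A_def B_def)
  show ?thesis
  \<comment> \<open>The factors come from dividing by the volume \<open>B\<close>, from the speed
    bound, from the kernel estimate and from the hypothesis on the maximal function; the final
    \<open>+ 1\<close> keeps the constant positive when \<open>\<kappa> = 0\<close>.\<close>
  proof (intro exI[of _ "1 / B * (C * (A * \<kappa>)) + 1"] conjI allI impI)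
    show "0 < 1 / B * (C * (A * \<kappa>)) + 1"
      using \<open>A \<ge> 0\<close> \<open>B > 0\<close> \<open>C > 0\<close> \<kappa> by (intro add_nonneg_pos mult_nonneg_nonneg) auto
    fix f :: "real ^ 'n \<Rightarrow> real" assume lip: "locally_lipschitz_on \<Omega> f"
    obtain G N where G [measurable]: "G \<in> borel_measurable borel" and N: "N \<in> null_sets lborel"
      and GD: "\<And>x. x \<in> \<Omega> - N \<Longrightarrow> GDERIV f x :> G x"
      using borel_gradient[OF \<open>open \<Omega>\<close> lip] by blast
    let ?I = "INF a::real. L1_norm_on \<Omega> (\<lambda>x. (f x - a) * w1 x)"
    let ?R = "L1_norm_on \<Omega> (\<lambda>x. (boundary_dist \<Omega> x * w2 x) *\<^sub>R gradient f x)"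
    let ?k = "john_kernel \<Omega> G \<rho> C"
    have k_meas [measurable]: "(\<lambda>x. ?k (a x) (b x) (c x)) \<in> borel_measurable M"
      if [measurable]: "a \<in> borel_measurable M" "b \<in> borel_measurable M" "c \<in> borel_measurable M" for a b c M
      using measurable_compose[of "\<lambda>x. (a x, b x, c x)" M borel "\<lambda>(s, x, y). ?k s x y" borel]
        borel_measurable_john_kernel[of \<Omega> G \<rho> C] by simp
    \<comment> \<open>The extension by zero is Borel on the whole space, as the double integral in
      \<open>y\<close> and \<open>z\<close> requires; it is evaluated against nonzero factors only
      at points of \<open>\<Omega>\<close>.\<close>
    define F where "F = (\<lambda>x. indicator \<Omega> x *\<^sub>R f x)"
    have [measurable]: "F \<in> borel_measurable borel"
      unfolding F_def using \<open>open \<Omega>\<close> lip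
      by (intro borel_measurable_continuous_on_indicator continuous_on_locally_lipschitz) auto
    have F_eq: "F x = f x" if "x \<in> \<Omega>" for x using that by (simp add: F_def)
    have shift: "x0 + z \<in> \<Omega>" if "z \<in> ball 0 \<rho>" for z
      using x0 that by (auto simp: dist_norm)

    \<comment> \<open>The infimum does not exceed the value at \<open>a = f (x0 + z)\<close> for any
      \<open>z\<close> in the ball, so it is integrated as a constant over that ball, of volume
      \<open>B\<close>.\<close>
    have "ennreal B * ?I = (\<integral>\<^sup>+z. ?I * indicator (ball (0 :: real ^ 'n) \<rho>) z \<partial>lborel)"
      using \<open>\<rho> > 0\<close> by (subst nn_integral_cmult_indicator) (simp_all add: B_def emeasure_ball mult.commute)
    also have "\<dots> \<le> (\<integral>\<^sup>+z. (\<integral>\<^sup>+y. indicator \<Omega> y * W y * (ennreal \<bar>F y - F (x0 + z)\<bar> * indicator (ball 0 \<rho>) z) \<partial>lborel) \<partial>lborel)"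
    proof (rule nn_integral_mono)
      fix z :: "real ^ 'n"
      show "?I * indicator (ball 0 \<rho>) z
          \<le> (\<integral>\<^sup>+y. indicator \<Omega> y * W y * (ennreal \<bar>F y - F (x0 + z)\<bar> * indicator (ball 0 \<rho>) z) \<partial>lborel)"
      proof (cases "z \<in> ball 0 \<rho>")
        case True
        have "?I \<le> L1_norm_on \<Omega> (\<lambda>y. (f y - f (x0 + z)) * w1 y)"
          by (rule INF_lower) simp
        also have "\<dots> = (\<integral>\<^sup>+y. indicator \<Omega> y * W y * ennreal \<bar>F y - F (x0 + z)\<bar> \<partial>lborel)"
          unfolding L1_norm_on_def nn_integral_completion
        proof (rule nn_integral_cong_AE)
          show "AE y in lborel. ennreal (norm ((f y - f (x0 + z)) * w1 y)) * indicator \<Omega> y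
              = indicator \<Omega> y * W y * ennreal \<bar>F y - F (x0 + z)\<bar>"
            using W_eq
          proof eventually_elim
            case (elim y)
            show ?case
            proof (cases "y \<in> \<Omega>")
              case y: True
              have "ennreal (norm ((f y - f (x0 + z)) * w1 y)) = W y * ennreal \<bar>f y - f (x0 + z)\<bar>"
                unfolding elim[symmetric] by (simp add: abs_mult ennreal_mult mult.commute)
              then show ?thesis using y shift[OF True] by (simp add: F_eq)
            qed simp
          qed
        qed
        finally show ?thesis using True by simp
      qed simp
    qed
    also have "\<dots> = (\<integral>\<^sup>+y. (\<integral>\<^sup>+z. indicator \<Omega> y * W y * (ennreal \<bar>F y - F (x0 + z)\<bar> * indicator (ball 0 \<rho>) z) \<partial>lborel) \<partial>lborel)"
      by (rule lborel_pair.Fubini') measurable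
    also have "\<dots> \<le> (\<integral>\<^sup>+y. ennreal C * (\<integral>\<^sup>+s. (\<integral>\<^sup>+x. W y * ?k s x y \<partial>lborel) \<partial>lborel) \<partial>lborel)"
    proof (rule nn_integral_mono)
      fix y :: "real ^ 'n"
      show "(\<integral>\<^sup>+z. indicator \<Omega> y * W y * (ennreal \<bar>F y - F (x0 + z)\<bar> * indicator (ball 0 \<rho>) z) \<partial>lborel)
          \<le> ennreal C * (\<integral>\<^sup>+s. (\<integral>\<^sup>+x. W y * ?k s x y \<partial>lborel) \<partial>lborel)"
      proof (cases "y \<in> \<Omega>")
        case True
        \<comment> \<open>A curve is picked separately for each \<open>y\<close>; only the
          curve-free kernel enters the outer integral, so no measurable choice is involved.\<close>
        from curves[OF this] obtain \<gamma> where \<gamma>: "K-lipschitz_on UNIV \<gamma>"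
            "AE s\<in>{0..1} in lebesgue. \<exists>v. (\<gamma> has_vector_derivative v) (at s within {0..1}) \<and> norm v \<le> K"
            "\<gamma> 0 = y" "\<gamma> 1 = x0" "\<forall>s\<in>{0..1}. \<gamma> s \<in> \<Omega> \<and> 2 * \<rho> * s \<le> boundary_dist \<Omega> (\<gamma> s)"
          by (elim exE conjE) (rule that)
        have est: "(\<integral>\<^sup>+z\<in>ball 0 \<rho>. ennreal \<bar>f (\<gamma> 0) - f (\<gamma> 1 + z)\<bar> \<partial>lborel)
            \<le> ennreal (K + \<rho>) * (\<integral>\<^sup>+s. (\<integral>\<^sup>+x. john_kernel \<Omega> G \<rho> (K + \<rho>) s x (\<gamma> 0) \<partial>lborel) \<partial>lborel)"
          by (rule nn_integral_increments_le[OF \<open>open \<Omega>\<close> lip G N GD \<gamma>(1,2) \<open>\<rho> > 0\<close> \<gamma>(5)[rule_format]])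
        have "(\<integral>\<^sup>+z. indicator \<Omega> y * W y * (ennreal \<bar>F y - F (x0 + z)\<bar> * indicator (ball 0 \<rho>) z) \<partial>lborel)
            = W y * (\<integral>\<^sup>+z\<in>ball 0 \<rho>. ennreal \<bar>F y - F (x0 + z)\<bar> \<partial>lborel)"
          using True by (simp add: nn_integral_cmult)
        also have "(\<integral>\<^sup>+z\<in>ball 0 \<rho>. ennreal \<bar>F y - F (x0 + z)\<bar> \<partial>lborel)
            = (\<integral>\<^sup>+z\<in>ball 0 \<rho>. ennreal \<bar>f (\<gamma> 0) - f (\<gamma> 1 + z)\<bar> \<partial>lborel)"
          using True shift by (intro nn_integral_cong) (simp add: F_eq \<gamma>(3,4) indicator_def)
        also note est
        also have "ennreal (K + \<rho>) * (\<integral>\<^sup>+s. (\<integral>\<^sup>+x. john_kernel \<Omega> G \<rho> (K + \<rho>) s x (\<gamma> 0) \<partial>lborel) \<partial>lborel)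
            = ennreal C * (\<integral>\<^sup>+s. (\<integral>\<^sup>+x. ?k s x y \<partial>lborel) \<partial>lborel)"
          by (simp add: C_def \<gamma>(3))
        also have "W y * (ennreal C * (\<integral>\<^sup>+s. (\<integral>\<^sup>+x. ?k s x y \<partial>lborel) \<partial>lborel))
            = ennreal C * (\<integral>\<^sup>+s. (\<integral>\<^sup>+x. W y * ?k s x y \<partial>lborel) \<partial>lborel)"
          by (simp add: nn_integral_cmult mult.left_commute)
        finally show ?thesis by (simp add: mult_left_mono)
      qed simp
    qed
    also have "\<dots> = ennreal C * (\<integral>\<^sup>+y. (\<integral>\<^sup>+s. (\<integral>\<^sup>+x. W y * ?k s x y \<partial>lborel) \<partial>lborel) \<partial>lborel)"
      by (rule nn_integral_cmult) measurable
    also have "(\<integral>\<^sup>+y. (\<integral>\<^sup>+s. (\<integral>\<^sup>+x. W y * ?k s x y \<partial>lborel) \<partial>lborel) \<partial>lborel)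
        = (\<integral>\<^sup>+x. (\<integral>\<^sup>+s. (\<integral>\<^sup>+y. W y * ?k s x y \<partial>lborel) \<partial>lborel) \<partial>lborel)"
      by (rule tonelli_rotate) (unfold borel_prod[symmetric], measurable)
    \<comment> \<open>The integral moves to \<open>lebesgue\<close>, where the comparison of the
      maximal function with \<open>w2\<close> is assumed and \<open>w2\<close> is
      measurable.\<close>
    also have "\<dots> \<le> (\<integral>\<^sup>+x. ennreal A * (ennreal (boundary_dist \<Omega> x * norm (G x)) * indicator \<Omega> x * maximal_function w1 x) \<partial>lebesgue)"
      unfolding nn_integral_completion A_def
      by (intro nn_integral_mono nn_integral_john_kernel_le[OF \<open>\<rho> > 0\<close> \<open>C > 0\<close> W W_eq])
    also have "\<dots> \<le> (\<integral>\<^sup>+x. ennreal (A * \<kappa>) * (ennreal (norm ((boundary_dist \<Omega> x * w2 x) *\<^sub>R G x)) * indicator \<Omega> x) \<partial>lebesgue)"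
    proof (rule nn_integral_mono_AE)
      show "AE x in lebesgue. ennreal A * (ennreal (boundary_dist \<Omega> x * norm (G x)) * indicator \<Omega> x * maximal_function w1 x)
          \<le> ennreal (A * \<kappa>) * (ennreal (norm ((boundary_dist \<Omega> x * w2 x) *\<^sub>R G x)) * indicator \<Omega> x)"
        using max
      proof eventually_elim
        case (elim x)
        have d: "0 \<le> boundary_dist \<Omega> x" by (simp add: boundary_dist_def infdist_nonneg)
        have "ennreal A * (ennreal (boundary_dist \<Omega> x * norm (G x)) * indicator \<Omega> x * maximal_function w1 x)
            \<le> ennreal A * (ennreal (boundary_dist \<Omega> x * norm (G x)) * indicator \<Omega> x * (ennreal \<kappa> * ennreal (w2 x)))"
          by (intro mult_left_mono elim) auto
        also have "\<dots> = (ennreal A * ennreal \<kappa>) * ((ennreal (boundary_dist \<Omega> x * norm (G x)) * ennreal (w2 x)) * indicator \<Omega> x)"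
          by (simp only: mult_ac)
        also have "\<dots> = ennreal (A * \<kappa>) * (ennreal (norm ((boundary_dist \<Omega> x * w2 x) *\<^sub>R G x)) * indicator \<Omega> x)"
          using d \<kappa> \<open>A \<ge> 0\<close> assms(5)[of x] by (simp add: ennreal_mult'[symmetric] abs_mult mult_ac)
        finally show ?case .
      qed
    qed
    also have "\<dots> = ennreal (A * \<kappa>) * (\<integral>\<^sup>+x. ennreal (norm ((boundary_dist \<Omega> x * w2 x) *\<^sub>R G x)) * indicator \<Omega> x \<partial>lebesgue)"
    proof (rule nn_integral_cmult)
      have [measurable]: "G \<in> borel_measurable lebesgue" "boundary_dist \<Omega> \<in> borel_measurable lebesgue" "\<Omega> \<in> sets lebesgue"
        by (auto intro: measurable_completion)
      note [measurable] = assms(4)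
      show "(\<lambda>x. ennreal (norm ((boundary_dist \<Omega> x * w2 x) *\<^sub>R G x)) * indicator \<Omega> x) \<in> borel_measurable lebesgue"
        by measurable
    qed
    also have "(\<integral>\<^sup>+x. ennreal (norm ((boundary_dist \<Omega> x * w2 x) *\<^sub>R G x)) * indicator \<Omega> x \<partial>lebesgue) = ?R"
      unfolding L1_norm_on_def
    proof (rule nn_integral_cong_AE)
      \<comment> \<open>Off \<open>N\<close> the Borel representative \<open>G\<close> is the
        gradient, by uniqueness of derivatives.\<close>
      have "AE x in lebesgue. x \<notin> N"
        by (intro AE_completion AE_not_in N)
      then show "AE x in lebesgue. ennreal (norm ((boundary_dist \<Omega> x * w2 x) *\<^sub>R G x)) * indicator \<Omega> x
          = ennreal (norm ((boundary_dist \<Omega> x * w2 x) *\<^sub>R gradient f x)) * indicator \<Omega> x"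
      proof eventually_elim
        case (elim x)
        then show ?case
          using gradient_eqI[OF GD[of x]] by (cases "x \<in> \<Omega>") auto
      qed
    qed
    finally have main: "ennreal B * ?I \<le> ennreal C * (ennreal (A * \<kappa>) * ?R)"
      by (simp add: mult_left_mono)
    have "?I = ennreal (1 / B) * (ennreal B * ?I)"
      using \<open>B > 0\<close> by (simp add: mult.assoc[symmetric] ennreal_mult'[symmetric])
    also have "\<dots> \<le> ennreal (1 / B) * (ennreal C * (ennreal (A * \<kappa>) * ?R))"
      using main by (intro mult_left_mono) auto
    also have "\<dots> = ennreal (1 / B * (C * (A * \<kappa>))) * ?R"
      using \<open>A \<ge> 0\<close> \<open>B > 0\<close> \<open>C > 0\<close> \<kappa> by (simp add: mult.assoc[symmetric] ennreal_mult'[symmetric])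
    also have "\<dots> \<le> ennreal (1 / B * (C * (A * \<kappa>)) + 1) * ?R"
      by (intro mult_right_mono ennreal_leI) auto
    finally show "?I \<le> ennreal (1 / B * (C * (A * \<kappa>)) + 1) * ?R" .
  qed
qed

end
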